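(* Let $s\ge 1$ and $d\ge 1$ be integers. There exists an adaptive one-sided error tester for the property "$s$-binary rank at most $d$" of $n\times m$ $(0,1)$-matrices that makes $O\!\left(d\binom{d}{\le s}2^d/\epsilon\right)=\tilde O\!\left(\binom{d}{\le s}2^d/\epsilon\right)$ queries. The same query bound is achievable by an adaptive one-sided error tester for the property "$s$-binary rank exactly $d$".
   Context: For a $(0,1)$-matrix $M$ of size $n\times m$, $M[i,j]$ denotes its $(i,j)$ entry and $[n]=\{1,\dots,n\}$. The $s$-binary rank ${\rm br}_s(M)$ is the minimal integer $d\ge 0$ such that there exist $d$ sets (rectangles) $I_k\times J_k$ with $I_k\subseteq[n]$, $J_k\subseteq[m]$, $k\in[d]$, with $M[i,j]=1$ for all $(i,j)\in I_k\times J_k$ and all $k$, and such that every $(i,j)$ with $M[i,j]=1$ lies in at least one and at most $s$ of the rectangles. $\binom{d}{\le s}=\sum_{i=0}^{s}\binom{d}{i}$. A matrix $M$ is $\epsilon$-far from a property if more than an $\epsilon$-fraction of its $nm$ entries must be modified to obtain a matrix with the property. A tester receives $0<\epsilon<1$, $d,s,n,m$ and query access to the entries of $M$; if $M$ has the property it accepts with probability at least $2/3$, and if $M$ is $\epsilon$-far from the property it rejects with probability at least $2/3$. It is one-sided if it accepts matrices with the property with probability $1$. It is adaptive if queries may depend on previous answers. $\tilde O$ hides factors polylogarithmic in $\binom{d}{\le s}2^d$ and $1/\epsilon$. *)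

theory Defs
  imports "HOL-Probability.Probability"
begin

text \<open>Matrices: an n x m (0,1)-matrix is a function M :: nat => nat => bool,
  of which only the entries with i < n, j < m matter (0-based indices).\<close>

type_synonym bmatrix = "nat \<Rightarrow> nat \<Rightarrow> bool"

text \<open>A cover witnessing s-binary rank at most d (with exactly d rectangles,
  possibly empty, indexed by k < d).\<close>
definition sbr_cover :: "nat \<Rightarrow> nat \<Rightarrow> nat \<Rightarrow> bmatrix \<Rightarrow> nat \<Rightarrow> bool" where
  "sbr_cover s n m M d \<longleftrightarrow>
     (\<exists>I J :: nat \<Rightarrow> nat set.
        (\<forall>k<d. I k \<subseteq> {..<n} \<and> J k \<subseteq> {..<m} \<and> (\<forall>i\<in>I k. \<forall>j\<in>J k. M i j)) \<and>
        (\<forall>i<n. \<forall>j<m. M i j \<longrightarrow>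
            1 \<le> card {k. k < d \<and> i \<in> I k \<and> j \<in> J k} \<and>
            card {k. k < d \<and> i \<in> I k \<and> j \<in> J k} \<le> s))"

definition sbrank :: "nat \<Rightarrow> nat \<Rightarrow> nat \<Rightarrow> bmatrix \<Rightarrow> nat" where
  "sbrank s n m M = (LEAST d. sbr_cover s n m M d)"

definition binom_le :: "nat \<Rightarrow> nat \<Rightarrow> nat" where
  "binom_le d s = (\<Sum>i\<le>s. d choose i)"

definition mat_dist :: "nat \<Rightarrow> nat \<Rightarrow> bmatrix \<Rightarrow> bmatrix \<Rightarrow> nat" where
  "mat_dist n m M M' = card {(i, j). i < n \<and> j < m \<and> M i j \<noteq> M' i j}"

definition eps_far :: "(bmatrix \<Rightarrow> bool) \<Rightarrow> real \<Rightarrow> nat \<Rightarrow> nat \<Rightarrow> bmatrix \<Rightarrow> bool" where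
  "eps_far P eps n m M \<longleftrightarrow>
     (\<forall>M'. P M' \<longrightarrow> real (mat_dist n m M M') > eps * real n * real m)"

text \<open>Deterministic adaptive query algorithms: decision trees that query an
  entry (i,j) and continue depending on the answer.\<close>
datatype qtree = Leaf bool | Query "nat \<times> nat" "bool \<Rightarrow> qtree"

primrec run :: "qtree \<Rightarrow> bmatrix \<Rightarrow> bool" where
  "run (Leaf b) M = b"
| "run (Query q f) M = (\<lambda>b. run (f b) M) (M (fst q) (snd q))"

primrec depth :: "qtree \<Rightarrow> nat" where
  "depth (Leaf b) = 0"
| "depth (Query q f) = Suc (max ((depth \<circ> f) True) ((depth \<circ> f) False))"

primrec queries :: "qtree \<Rightarrow> (nat \<times> nat) set" where
  "queries (Leaf b) = {}"
| "queries (Query q f) = insert q ((queries \<circ> f) True \<union> (queries \<circ> f) False)"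

definition one_sided_adaptive_tester ::
  "(nat \<Rightarrow> nat \<Rightarrow> nat \<Rightarrow> nat \<Rightarrow> bmatrix \<Rightarrow> bool) \<Rightarrow>
   (real \<Rightarrow> nat \<Rightarrow> nat \<Rightarrow> nat \<Rightarrow> nat \<Rightarrow> real) \<Rightarrow>
   (real \<Rightarrow> nat \<Rightarrow> nat \<Rightarrow> nat \<Rightarrow> nat \<Rightarrow> qtree pmf) \<Rightarrow> bool" where
  "one_sided_adaptive_tester P q T \<longleftrightarrow>
     (\<forall>eps d s n m. 0 < eps \<and> eps < 1 \<and> 1 \<le> d \<and> 1 \<le> s \<and> 1 \<le> n \<and> 1 \<le> m \<longrightarrow>
        (\<forall>t\<in>set_pmf (T eps d s n m).
            queries t \<subseteq> {..<n} \<times> {..<m} \<and> real (depth t) \<le> q eps d s n m) \<and>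
        (\<forall>M. P s d n m M \<longrightarrow> measure_pmf.prob (T eps d s n m) {t. run t M} = 1) \<and>
        (\<forall>M. eps_far (P s d n m) eps n m M \<longrightarrow>
              measure_pmf.prob (T eps d s n m) {t. \<not> run t M} \<ge> 2/3))"

end

theory Submission
  imports Defs
begin

text \<open>The tester grows a submatrix \<open>X \<times> Y\<close> with pairwise distinct rows and pairwise distinct
  columns. If the rank is at most \<open>d\<close>, each row and each column is encoded by the set of rectangles
  that it meets; a row set and a column set share at most \<open>s\<close> elements, and Sgall's bound on pairs of
  families with this property gives \<open>|X| |Y| \<le> K = binom_le d s * 2 ^ d\<close>. If the matrix is far from
  rank at most \<open>d\<close> but the submatrix has rank at most \<open>d\<close>, then the matrix differs in more than an
  \<open>eps\<close>-fraction of the entries from the blow-up of the submatrix, and for each such entry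
  \<open>(i, j)\<close> the submatrix can be extended by the row \<open>i\<close>, the column \<open>j\<close> or both. A stage tries
  \<open>O(d / eps)\<close> random pairs, so with probability at least 2/3 none of the at most
  \<open>K \<le> 4 ^ d\<close> stages gets stuck. Cheap extensions are tried first, so that a stage
  costs \<open>O(d / eps)\<close> times the increase of \<open>|X| |Y|\<close>, which gives \<open>O(d K / eps)\<close> in total.

  For rank exactly \<open>d\<close> one uses that a matrix of rank at most \<open>d\<close> becomes one of rank \<open>d\<close> by
  changing at most \<open>d * d\<close> entries, provided that \<open>d \<le> min n m\<close>.\<close>

section \<open>Pairs of set families with bounded intersections\<close>

lemma binom_le_Suc_Suc: "binom_le (Suc d) (Suc s) = binom_le d (Suc s) + binom_le d s"
proof -
  have "binom_le (Suc d) (Suc s) = 1 + (\<Sum>i\<le>s. Suc d choose Suc i)"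
    unfolding binom_le_def by (subst sum.atMost_Suc_shift) simp
  also have "\<dots> = (1 + (\<Sum>i\<le>s. d choose Suc i)) + (\<Sum>i\<le>s. d choose i)"
    by (simp add: sum.distrib)
  also have "1 + (\<Sum>i\<le>s. d choose Suc i) = binom_le d (Suc s)"
    unfolding binom_le_def by (subst sum.atMost_Suc_shift) simp
  finally show ?thesis by (simp add: binom_le_def)
qed

lemma binom_le_0_right [simp]: "binom_le d 0 = 1"
  by (simp add: binom_le_def)

lemma binom_le_pos: "1 \<le> binom_le d s"
proof -
  have "(\<Sum>i\<in>{0}. d choose i) \<le> binom_le d s"
    unfolding binom_le_def by (rule sum_mono2) auto
  then show ?thesis by simp
qed

lemma binom_le_le_power: "binom_le d s \<le> 2 ^ d"
proof -
  have "binom_le d s \<le> (\<Sum>i\<le>max s d. d choose i)"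
    unfolding binom_le_def by (rule sum_mono2) auto
  also have "\<dots> = (\<Sum>i\<le>d. d choose i)"
    by (rule sum.mono_neutral_right) auto
  finally show ?thesis by (simp add: choose_row_sum)
qed

text \<open>The right side minus the left side is \<open>(u - i) * (v - j)\<close>, which is
  nonnegative.\<close>

lemma rearrangement_double:
  fixes u v i j :: nat
  assumes "i \<le> u" "j \<le> v"
  shows "(u + i) * (v + j) \<le> 2 * (u * v) + 2 * (i * j)"
proof -
  obtain p q where "u = i + p" "v = j + q" using assms le_Suc_ex by blast
  then show ?thesis by (simp add: algebra_simps)
qed

text \<open>Deleting \<open>k\<close> sends at most two members of the family to the same set, and
  exactly two when that set lies in \<open>\<I>\<close>.\<close>

lemma card_split_element:
  fixes \<A> :: "'a set set" and k :: 'a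
  assumes "finite \<A>"
  defines "\<U> \<equiv> (\<lambda>A. A - {k}) ` \<A>"
    and "\<I> \<equiv> {A. k \<notin> A \<and> A \<in> \<A> \<and> insert k A \<in> \<A>}"
  shows "card \<A> = card \<U> + card \<I>" "card \<I> \<le> card \<U>"
proof -
  let ?A0 = "{A \<in> \<A>. k \<notin> A}" and ?A1 = "{A \<in> \<A>. k \<in> A}"
  let ?D = "(\<lambda>A. A - {k}) ` ?A1"
  have fin: "finite ?A0" "finite ?A1" using assms(1) by auto
  have inj: "inj_on (\<lambda>A. A - {k}) ?A1"
    by (rule inj_onI) (metis (mono_tags, lifting) insert_Diff mem_Collect_eq)
  have "card \<A> = card ?A0 + card ?A1"
  proof -
    have "\<A> = ?A0 \<union> ?A1" by auto
    moreover have "card (?A0 \<union> ?A1) = card ?A0 + card ?A1"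
      by (rule card_Un_disjoint) (use fin in auto)
    ultimately show ?thesis by simp
  qed
  also have "card ?A1 = card ?D" using inj by (simp add: card_image)
  also have "card ?A0 + card ?D = card (?A0 \<union> ?D) + card (?A0 \<inter> ?D)"
    by (rule card_Un_Int) (use fin in auto)
  also have "?A0 \<union> ?D = \<U>"
  proof
    show "?A0 \<union> ?D \<subseteq> \<U>"
    proof
      fix x assume "x \<in> ?A0 \<union> ?D"
      then show "x \<in> \<U>"
      proof
        assume "x \<in> ?A0"
        then have "x = x - {k}" "x \<in> \<A>" by auto
        then show ?thesis unfolding \<U>_def by (rule image_eqI)
      qed (auto simp: \<U>_def)
    qed
    show "\<U> \<subseteq> ?A0 \<union> ?D"
    proof
      fix x assume "x \<in> \<U>"
      then obtain A where "A \<in> \<A>" "x = A - {k}" by (auto simp: \<U>_def)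
      then show "x \<in> ?A0 \<union> ?D" by (cases "k \<in> A") auto
    qed
  qed
  also have "?A0 \<inter> ?D = \<I>"
  proof
    show "?A0 \<inter> ?D \<subseteq> \<I>" by (auto simp: \<I>_def insert_absorb)
    show "\<I> \<subseteq> ?A0 \<inter> ?D"
    proof
      fix x assume x: "x \<in> \<I>"
      then have "x = insert k x - {k}" "insert k x \<in> ?A1" by (auto simp: \<I>_def)
      then have "x \<in> ?D" by (rule image_eqI)
      then show "x \<in> ?A0 \<inter> ?D" using x by (auto simp: \<I>_def)
    qed
  qed
  finally show "card \<A> = card \<U> + card \<I>" .
  show "card \<I> \<le> card \<U>"
  proof (rule card_mono)
    show "finite \<U>" using assms(1) by (simp add: \<U>_def)
    show "\<I> \<subseteq> \<U>"
    proof
      fix x assume "x \<in> \<I>"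
      then have "x = x - {k}" "x \<in> \<A>" by (auto simp: \<I>_def)
      then show "x \<in> \<U>" unfolding \<U>_def by (rule image_eqI)
    qed
  qed
qed

text \<open>Induction on \<open>d\<close>. Deleting the last element keeps intersections at most
  \<open>s\<close>. Among sets that occur both with and without it they are at most
  \<open>s - 1\<close>, since both can be taken with it. \<open>rearrangement_double\<close> turns
  these two bounds into the recursion of \<open>binom_le_Suc_Suc\<close>, with a factor 2 per
  element.\<close>

lemma card_families_bounded_intersection:
  assumes "\<A> \<subseteq> Pow {..<d}" "\<B> \<subseteq> Pow {..<d}"
    and "\<And>A B. A \<in> \<A> \<Longrightarrow> B \<in> \<B> \<Longrightarrow> card (A \<inter> B) \<le> s"
  shows "card \<A> * card \<B> \<le> binom_le d s * 2 ^ d"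
  using assms
proof (induction d arbitrary: \<A> \<B> s)
  case 0
  then have "card \<A> \<le> card {{} :: nat set}" "card \<B> \<le> card {{} :: nat set}"
    by (intro card_mono; auto)+
  then have "card \<A> * card \<B> \<le> 1 * 1" by (intro mult_mono) auto
  then show ?case using binom_le_pos[of 0 s] by simp
next
  case (Suc d)
  define U where "U = (\<lambda>\<F> :: nat set set. (\<lambda>A. A - {d}) ` \<F>)"
  define I where "I = (\<lambda>\<F> :: nat set set. {A. d \<notin> A \<and> A \<in> \<F> \<and> insert d A \<in> \<F>})"
  have fin: "finite \<A>" "finite \<B>"
    using Suc.prems(1,2) by (auto intro: finite_subset)
  have finS: "finite A" if "A \<in> \<A> \<union> \<B>" for A
    using that Suc.prems(1,2) by (auto intro: finite_subset)
  have sub: "A - {d} \<subseteq> {..<d}" if "A \<in> \<A> \<union> \<B>" for A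
  proof -
    have "A \<subseteq> {..<Suc d}" using that Suc.prems(1,2) by blast
    then show ?thesis by (auto simp: lessThan_Suc)
  qed
  have UP: "U \<A> \<subseteq> Pow {..<d}" "U \<B> \<subseteq> Pow {..<d}" using sub by (auto simp: U_def)
  have "I \<A> \<subseteq> U \<A>" "I \<B> \<subseteq> U \<B>" unfolding I_def U_def by (auto simp: image_iff)
  then have IP: "I \<A> \<subseteq> Pow {..<d}" "I \<B> \<subseteq> Pow {..<d}" using UP by auto
  have UU: "card (U \<A>) * card (U \<B>) \<le> binom_le d s * 2 ^ d"
  proof (rule Suc.IH[OF UP])
    fix A B assume "A \<in> U \<A>" "B \<in> U \<B>"
    then obtain A' B' where *: "A' \<in> \<A>" "B' \<in> \<B>" "A = A' - {d}" "B = B' - {d}"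
      by (auto simp: U_def)
    have "card (A \<inter> B) \<le> card (A' \<inter> B')"
      by (rule card_mono) (use * finS in auto)
    then show "card (A \<inter> B) \<le> s" using Suc.prems(3) * le_trans by blast
  qed
  have II: "Suc (card (A \<inter> B)) \<le> s" if "A \<in> I \<A>" "B \<in> I \<B>" for A B
  proof -
    have "d \<notin> A" "insert d A \<in> \<A>" "insert d B \<in> \<B>" "A \<in> \<A>" using that by (auto simp: I_def)
    moreover have "card (insert d A \<inter> insert d B) = Suc (card (A \<inter> B))"
      using \<open>d \<notin> A\<close> finS[of A] \<open>A \<in> \<A>\<close> by simp
    ultimately show ?thesis using Suc.prems(3) by metis
  qed
  have "card \<A> * card \<B> = (card (U \<A>) + card (I \<A>)) * (card (U \<B>) + card (I \<B>))"
    using card_split_element(1)[OF fin(1), of d] card_split_element(1)[OF fin(2), of d]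
    by (simp add: U_def I_def)
  also have "\<dots> \<le> 2 * (card (U \<A>) * card (U \<B>)) + 2 * (card (I \<A>) * card (I \<B>))"
    using card_split_element(2)[OF fin(1), of d] card_split_element(2)[OF fin(2), of d]
    by (intro rearrangement_double) (simp_all add: U_def I_def)
  also have "\<dots> \<le> binom_le (Suc d) s * 2 ^ Suc d"
  proof (cases s)
    case 0
    \<comment> \<open>Otherwise two members, one from each side, would extend to sets sharing
      \<open>d\<close>.\<close>
    then have "I \<A> = {} \<or> I \<B> = {}" using II by fastforce
    then have "card (I \<A>) * card (I \<B>) = 0" by auto
    then show ?thesis using UU 0 by (simp only: binom_le_0_right) simp
  next
    case (Suc s')
    have "card (I \<A>) * card (I \<B>) \<le> binom_le d s' * 2 ^ d"
      by (rule Suc.IH[OF IP]) (use II Suc in fastforce)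
    then show ?thesis using UU Suc by (simp add: binom_le_Suc_Suc algebra_simps)
  qed
  finally show ?case .
qed

section \<open>Covers of submatrices\<close>

text \<open>The row and column sets are arbitrary because the submatrices grown by the tester need
  not be initial segments.\<close>

definition cover_on :: "nat \<Rightarrow> nat set \<Rightarrow> nat set \<Rightarrow> bmatrix \<Rightarrow> nat \<Rightarrow> bool" where
  "cover_on s X Y M d \<longleftrightarrow>
     (\<exists>I J :: nat \<Rightarrow> nat set.
        (\<forall>k<d. I k \<subseteq> X \<and> J k \<subseteq> Y \<and> (\<forall>i\<in>I k. \<forall>j\<in>J k. M i j)) \<and>
        (\<forall>i\<in>X. \<forall>j\<in>Y. M i j \<longrightarrow>
            1 \<le> card {k. k < d \<and> i \<in> I k \<and> j \<in> J k} \<and>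
            card {k. k < d \<and> i \<in> I k \<and> j \<in> J k} \<le> s))"

lemma sbr_cover_iff_cover_on: "sbr_cover s n m M d \<longleftrightarrow> cover_on s {..<n} {..<m} M d"
  unfolding sbr_cover_def cover_on_def Ball_def lessThan_iff ..

lemma cover_on_cong:
  assumes "\<And>i j. i \<in> X \<Longrightarrow> j \<in> Y \<Longrightarrow> M i j = M' i j"
  shows "cover_on s X Y M d = cover_on s X Y M' d"
  unfolding cover_on_def using assms by (intro ex_cong1 conj_cong refl) (blast | simp)+

lemma cover_on_submatrix:
  assumes "cover_on s X Y M d" "X' \<subseteq> X" "Y' \<subseteq> Y"
  shows "cover_on s X' Y' M d"
proof -
  obtain I J where
    1: "\<forall>k<d. I k \<subseteq> X \<and> J k \<subseteq> Y \<and> (\<forall>i\<in>I k. \<forall>j\<in>J k. M i j)" and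
    2: "\<forall>i\<in>X. \<forall>j\<in>Y. M i j \<longrightarrow>
            1 \<le> card {k. k < d \<and> i \<in> I k \<and> j \<in> J k} \<and>
            card {k. k < d \<and> i \<in> I k \<and> j \<in> J k} \<le> s"
    using assms(1) unfolding cover_on_def by auto
  show ?thesis unfolding cover_on_def
  proof (rule exI[of _ "\<lambda>k. I k \<inter> X'"], rule exI[of _ "\<lambda>k. J k \<inter> Y'"], intro conjI ballI impI)
    show "\<forall>k<d. I k \<inter> X' \<subseteq> X' \<and> J k \<inter> Y' \<subseteq> Y' \<and> (\<forall>i\<in>I k \<inter> X'. \<forall>j\<in>J k \<inter> Y'. M i j)"
      using 1 by auto
    fix i j assume ij: "i \<in> X'" "j \<in> Y'" "M i j"
    then have "{k. k < d \<and> i \<in> I k \<inter> X' \<and> j \<in> J k \<inter> Y'} = {k. k < d \<and> i \<in> I k \<and> j \<in> J k}"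
      by auto
    then show "1 \<le> card {k. k < d \<and> i \<in> I k \<inter> X' \<and> j \<in> J k \<inter> Y'}"
      "card {k. k < d \<and> i \<in> I k \<inter> X' \<and> j \<in> J k \<inter> Y'} \<le> s"
      using 2 ij assms(2,3) by auto
  qed
qed

lemma cover_on_mono:
  assumes "cover_on s X Y M d" "d \<le> d'"
  shows "cover_on s X Y M d'"
proof -
  obtain I J where
    1: "\<forall>k<d. I k \<subseteq> X \<and> J k \<subseteq> Y \<and> (\<forall>i\<in>I k. \<forall>j\<in>J k. M i j)" and
    2: "\<forall>i\<in>X. \<forall>j\<in>Y. M i j \<longrightarrow>
            1 \<le> card {k. k < d \<and> i \<in> I k \<and> j \<in> J k} \<and>
            card {k. k < d \<and> i \<in> I k \<and> j \<in> J k} \<le> s"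
    using assms(1) unfolding cover_on_def by auto
  let ?I = "\<lambda>k. if k < d then I k else {}"
  have eq: "{k. k < d' \<and> i \<in> ?I k \<and> j \<in> J' k} = {k. k < d \<and> i \<in> I k \<and> j \<in> J k}"
    if "J' = (\<lambda>k. if k < d then J k else {})" for i j J'
    using assms(2) that by (auto split: if_splits)
  show ?thesis unfolding cover_on_def
    by (rule exI[of _ ?I], rule exI[of _ "\<lambda>k. if k < d then J k else {}"])
      (use 1 2 in \<open>simp only: eq[OF refl], auto\<close>)
qed

lemma cover_on_transpose:
  assumes "cover_on s X Y M d"
  shows "cover_on s Y X (\<lambda>i j. M j i) d"
proof -
  obtain I J where
    1: "\<forall>k<d. I k \<subseteq> X \<and> J k \<subseteq> Y \<and> (\<forall>i\<in>I k. \<forall>j\<in>J k. M i j)" and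
    2: "\<forall>i\<in>X. \<forall>j\<in>Y. M i j \<longrightarrow>
            1 \<le> card {k. k < d \<and> i \<in> I k \<and> j \<in> J k} \<and>
            card {k. k < d \<and> i \<in> I k \<and> j \<in> J k} \<le> s"
    using assms(1) unfolding cover_on_def by auto
  have eq: "{k. k < d \<and> j \<in> J k \<and> i \<in> I k} = {k. k < d \<and> i \<in> I k \<and> j \<in> J k}" for i j
    by auto
  show ?thesis unfolding cover_on_def
    by (rule exI[of _ J], rule exI[of _ I]) (use 1 2 in \<open>simp only: eq, auto\<close>)
qed

section \<open>The rank as a least cover size\<close>

lemma cover_on_rows:
  assumes "1 \<le> s"
  shows "cover_on s {..<n} Y M n"
proof -
  \<comment> \<open>With one rectangle per row, every 1 is covered exactly once.\<close>
  have eq: "{k. k < n \<and> i \<in> {k} \<and> j \<in> {j\<in>Y. M k j}} = {i}" if "i < n" "j \<in> Y" "M i j" for i j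
    using that by auto
  show ?thesis unfolding cover_on_def
  proof (rule exI[of _ "\<lambda>k. {k}"], rule exI[of _ "\<lambda>k. {j\<in>Y. M k j}"], intro conjI ballI impI)
    fix i j assume "i \<in> {..<n}" "j \<in> Y" "M i j"
    then show "1 \<le> card {k. k < n \<and> i \<in> {k} \<and> j \<in> {j\<in>Y. M k j}}"
      "card {k. k < n \<and> i \<in> {k} \<and> j \<in> {j\<in>Y. M k j}} \<le> s"
      using assms eq[of i j] by simp_all
  qed auto
qed

text \<open>The \<open>LEAST\<close> in \<open>sbrank\<close> ranges over a set that is nonempty by
  \<open>cover_on_rows\<close> and upward closed by \<open>cover_on_mono\<close>.\<close>

lemma sbrank_le_iff:
  assumes "1 \<le> s"
  shows "sbrank s n m M \<le> d \<longleftrightarrow> cover_on s {..<n} {..<m} M d"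
proof
  have "sbr_cover s n m M n" using cover_on_rows[OF assms] by (simp add: sbr_cover_iff_cover_on)
  then have "sbr_cover s n m M (sbrank s n m M)" unfolding sbrank_def by (rule LeastI)
  moreover assume "sbrank s n m M \<le> d"
  ultimately show "cover_on s {..<n} {..<m} M d"
    using cover_on_mono by (simp add: sbr_cover_iff_cover_on)
next
  assume "cover_on s {..<n} {..<m} M d"
  then show "sbrank s n m M \<le> d"
    unfolding sbrank_def by (intro Least_le) (simp add: sbr_cover_iff_cover_on)
qed

lemma sbrank_le_rows: "1 \<le> s \<Longrightarrow> sbrank s n m M \<le> n"
  by (simp add: sbrank_le_iff cover_on_rows)

lemma sbrank_le_cols: "1 \<le> s \<Longrightarrow> sbrank s n m M \<le> m"
  using cover_on_transpose[OF cover_on_rows[of s m "{..<n}" "\<lambda>i j. M j i"]]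
  by (simp add: sbrank_le_iff)

section \<open>Reaching rank exactly \<open>d\<close> by few changes\<close>

lemma cover_on_change_row:
  assumes cov: "cover_on s X Y M d" and s: "1 \<le> s"
    and eq: "\<And>i j. i \<in> X \<Longrightarrow> j \<in> Y \<Longrightarrow> i \<noteq> r \<Longrightarrow> M' i j = M i j"
  shows "cover_on s X Y M' (Suc d)"
proof -
  obtain I J where
    1: "\<forall>k<d. I k \<subseteq> X \<and> J k \<subseteq> Y \<and> (\<forall>i\<in>I k. \<forall>j\<in>J k. M i j)" and
    2: "\<forall>i\<in>X. \<forall>j\<in>Y. M i j \<longrightarrow>
            1 \<le> card {k. k < d \<and> i \<in> I k \<and> j \<in> J k} \<and>
            card {k. k < d \<and> i \<in> I k \<and> j \<in> J k} \<le> s"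
    using cov unfolding cover_on_def by auto
  \<comment> \<open>Row \<open>r\<close> is cut out of all old rectangles, and its new ones form a
    rectangle of their own, with index \<open>d\<close>.\<close>
  define I' where "I' = (\<lambda>k. if k < d then I k - {r} else {r} \<inter> X)"
  define J' where "J' = (\<lambda>k. if k < d then J k else {j\<in>Y. M' r j})"
  show ?thesis unfolding cover_on_def
  proof (rule exI[of _ I'], rule exI[of _ J'], rule conjI)
    show "\<forall>k<Suc d. I' k \<subseteq> X \<and> J' k \<subseteq> Y \<and> (\<forall>i\<in>I' k. \<forall>j\<in>J' k. M' i j)"
    proof (intro allI impI)
      fix k assume "k < Suc d"
      show "I' k \<subseteq> X \<and> J' k \<subseteq> Y \<and> (\<forall>i\<in>I' k. \<forall>j\<in>J' k. M' i j)"
      proof (cases "k < d")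
        case True
        then have *: "I k \<subseteq> X" "J k \<subseteq> Y" "\<forall>i\<in>I k. \<forall>j\<in>J k. M i j" using 1 by auto
        then have "\<forall>i\<in>I k - {r}. \<forall>j\<in>J k. M' i j" using eq by blast
        then show ?thesis using * True by (auto simp: I'_def J'_def)
      qed (auto simp: I'_def J'_def)
    qed
    show "\<forall>i\<in>X. \<forall>j\<in>Y. M' i j \<longrightarrow>
            1 \<le> card {k. k < Suc d \<and> i \<in> I' k \<and> j \<in> J' k} \<and>
            card {k. k < Suc d \<and> i \<in> I' k \<and> j \<in> J' k} \<le> s"
    proof (intro ballI impI)
      fix i j assume ij: "i \<in> X" "j \<in> Y" "M' i j"
      show "1 \<le> card {k. k < Suc d \<and> i \<in> I' k \<and> j \<in> J' k} \<and>
            card {k. k < Suc d \<and> i \<in> I' k \<and> j \<in> J' k} \<le> s"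
      proof (cases "i = r")
        case True
        then have "{k. k < Suc d \<and> i \<in> I' k \<and> j \<in> J' k} = {d}"
          using ij by (auto simp: I'_def J'_def split: if_splits)
        then show ?thesis using s by simp
      next
        case False
        then have "{k. k < Suc d \<and> i \<in> I' k \<and> j \<in> J' k} = {k. k < d \<and> i \<in> I k \<and> j \<in> J k}"
          by (auto simp: I'_def J'_def split: if_splits)
        then show ?thesis using 2 ij eq False by auto
      qed
    qed
  qed
qed

text \<open>The diagonal is a fooling set: a rectangle containing \<open>(i, i)\<close> and
  \<open>(j, j)\<close> also contains \<open>(i, j)\<close>, which is a 0 for distinct
  \<open>i\<close> and \<open>j\<close>. So the diagonal entries need \<open>d\<close> different
  rectangles.\<close>

lemma cover_on_identity_ge:
  assumes cov: "cover_on s X Y M r" and "{..<d} \<subseteq> X" "{..<d} \<subseteq> Y"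
    and M: "\<And>i j. i < d \<Longrightarrow> j < d \<Longrightarrow> M i j \<longleftrightarrow> i = j"
  shows "d \<le> r"
proof -
  obtain I J where
    1: "\<forall>k<r. I k \<subseteq> X \<and> J k \<subseteq> Y \<and> (\<forall>i\<in>I k. \<forall>j\<in>J k. M i j)" and
    2: "\<forall>i\<in>X. \<forall>j\<in>Y. M i j \<longrightarrow>
            1 \<le> card {k. k < r \<and> i \<in> I k \<and> j \<in> J k} \<and>
            card {k. k < r \<and> i \<in> I k \<and> j \<in> J k} \<le> s"
    using cov unfolding cover_on_def by auto
  have "\<exists>k<r. i \<in> I k \<and> i \<in> J k" if "i < d" for i
  proof -
    have "i \<in> X" "i \<in> Y" "M i i" using that assms(2,3) M by auto
    then have "1 \<le> card {k. k < r \<and> i \<in> I k \<and> i \<in> J k}" using 2 by blast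
    then have "{k. k < r \<and> i \<in> I k \<and> i \<in> J k} \<noteq> {}" by (metis card.empty not_one_le_zero)
    then show ?thesis by auto
  qed
  then obtain f where f: "\<And>i. i < d \<Longrightarrow> f i < r \<and> i \<in> I (f i) \<and> i \<in> J (f i)" by metis
  have "inj_on f {..<d}"
  proof (rule inj_onI)
    fix i j assume "i \<in> {..<d}" "j \<in> {..<d}" "f i = f j"
    then show "i = j" using f[of i] f[of j] M[of i j] 1 by auto
  qed
  moreover have "f ` {..<d} \<subseteq> {..<r}" using f by auto
  ultimately have "card {..<d} \<le> card {..<r}" by (rule card_inj_on_le) simp
  then show ?thesis by simp
qed

lemma mat_dist_le_card:
  assumes "finite S" "\<And>i j. M i j \<noteq> M' i j \<Longrightarrow> (i, j) \<in> S"
  shows "mat_dist n m M M' \<le> card S"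
  unfolding mat_dist_def by (rule card_mono) (use assms in auto)

lemma mat_dist_triangle: "mat_dist n m M M'' \<le> mat_dist n m M M' + mat_dist n m M' M''"
proof -
  let ?D = "\<lambda>(M :: bmatrix) M'. {(i, j). i < n \<and> j < m \<and> M i j \<noteq> M' i j}"
  have fin: "finite (?D M M')" for M M'
    by (rule finite_subset[of _ "{..<n} \<times> {..<m}"]) auto
  have "card (?D M M'') \<le> card (?D M M' \<union> ?D M' M'')"
    by (rule card_mono[OF finite_UnI[OF fin fin]]) auto
  also have "\<dots> \<le> card (?D M M') + card (?D M' M'')" by (rule card_Un_le)
  finally show ?thesis by (simp add: mat_dist_def)
qed

text \<open>Overwriting the rows of the top left \<open>d \<times> d\<close> block by those of the identity, one after the
  other, ends at rank at least \<open>d\<close>, and no step raises the rank by more than one.\<close>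

lemma close_to_sbrank_eq:
  assumes s: "1 \<le> s" and "sbrank s n m M \<le> d" and dn: "d \<le> n" "d \<le> m"
  obtains M' where "sbrank s n m M' = d" "mat_dist n m M M' \<le> d * d"
proof -
  define R where "R = (\<lambda>t i j. if i < t \<and> i < d \<and> j < d then i = j else M i j)"
  define f where "f = (\<lambda>t. sbrank s n m (R t))"
  have "R 0 = M" by (simp add: R_def)
  then have f0: "f 0 \<le> d" using assms by (simp add: f_def)
  have step: "f (Suc t) \<le> Suc (f t)" for t
  proof -
    have "cover_on s {..<n} {..<m} (R t) (f t)"
      using sbrank_le_iff[OF s, of n m "R t" "f t"] by (simp add: f_def)
    then have "cover_on s {..<n} {..<m} (R (Suc t)) (Suc (f t))"
      by (rule cover_on_change_row[where r = t, OF _ s]) (auto simp: R_def less_Suc_eq)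
    then show ?thesis by (simp add: sbrank_le_iff[OF s] f_def)
  qed
  have fd: "d \<le> f d"
  proof (rule cover_on_identity_ge)
    show "cover_on s {..<n} {..<m} (R d) (f d)"
      using sbrank_le_iff[OF s, of n m "R d" "f d"] by (simp add: f_def)
  qed (use dn in \<open>auto simp: R_def\<close>)
  \<comment> \<open>Discrete intermediate value argument: just before the first time at which
    \<open>f\<close> reaches \<open>d\<close> it is below \<open>d\<close>, so it cannot jump past
    \<open>d\<close>.\<close>
  define t where "t = (LEAST t. d \<le> f t)"
  have t: "d \<le> f t" unfolding t_def using fd by (rule LeastI)
  have "f t = d"
  proof (cases t)
    case 0
    then show ?thesis using t f0 by simp
  next
    case (Suc t')
    then have "\<not> d \<le> f t'" unfolding t_def by (metis lessI not_less_Least)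
    then show ?thesis using step[of t'] t Suc by simp
  qed
  moreover have "mat_dist n m M (R t) \<le> card ({..<d} \<times> {..<d})"
    by (rule mat_dist_le_card) (auto simp: R_def split: if_splits)
  ultimately show ?thesis using that[of "R t"] by (simp add: f_def)
qed

section \<open>Submatrices without repeated rows or columns\<close>

definition reduced_on :: "bmatrix \<Rightarrow> nat set \<Rightarrow> nat set \<Rightarrow> bool" where
  "reduced_on M X Y \<longleftrightarrow>
     (\<forall>x\<in>X. \<forall>x'\<in>X. (\<forall>y\<in>Y. M x y = M x' y) \<longrightarrow> x = x') \<and>
     (\<forall>y\<in>Y. \<forall>y'\<in>Y. (\<forall>x\<in>X. M x y = M x y') \<longrightarrow> y = y')"

lemma reduced_on_cong:
  assumes "\<And>i j. i \<in> X \<Longrightarrow> j \<in> Y \<Longrightarrow> M i j = M' i j"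
  shows "reduced_on M X Y = reduced_on M' X Y"
  unfolding reduced_on_def using assms by (intro conj_cong ball_cong imp_cong refl) simp_all

text \<open>An entry is 1 exactly when the codes \<open>a x\<close> and \<open>b y\<close> meet.
  Hence equal codes give equal rows or columns, and reducedness makes both codings injective. Codes
  share at most \<open>s\<close> rectangles at a 1 and none at a 0, so the bound on set families
  applies.\<close>

lemma card_reduced_on_le:
  assumes cov: "cover_on s X Y M d" and red: "reduced_on M X Y"
  shows "card X * card Y \<le> binom_le d s * 2 ^ d"
proof -
  obtain I J where
    1: "\<forall>k<d. I k \<subseteq> X \<and> J k \<subseteq> Y \<and> (\<forall>i\<in>I k. \<forall>j\<in>J k. M i j)" and
    2: "\<forall>i\<in>X. \<forall>j\<in>Y. M i j \<longrightarrow>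
            1 \<le> card {k. k < d \<and> i \<in> I k \<and> j \<in> J k} \<and>
            card {k. k < d \<and> i \<in> I k \<and> j \<in> J k} \<le> s"
    using cov unfolding cover_on_def by auto
  define a where "a = (\<lambda>x. {k. k < d \<and> x \<in> I k})"
  define b where "b = (\<lambda>y. {k. k < d \<and> y \<in> J k})"
  have ab: "a x \<inter> b y = {k. k < d \<and> x \<in> I k \<and> y \<in> J k}" for x y
    by (auto simp: a_def b_def)
  have M: "M x y \<longleftrightarrow> a x \<inter> b y \<noteq> {}" if "x \<in> X" "y \<in> Y" for x y
  proof
    assume "M x y"
    then have "1 \<le> card (a x \<inter> b y)" using 2 that by (simp add: ab)
    then show "a x \<inter> b y \<noteq> {}" by (metis card.empty not_one_le_zero)
  next
    assume "a x \<inter> b y \<noteq> {}"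
    then show "M x y" using 1 by (auto simp: ab)
  qed
  have "card (a x \<inter> b y) \<le> s" if "x \<in> X" "y \<in> Y" for x y
  proof (cases "M x y")
    case True
    then show ?thesis using 2 that unfolding ab by blast
  next
    case False
    then show ?thesis using M[OF that] by simp
  qed
  then have "card (a ` X) * card (b ` Y) \<le> binom_le d s * 2 ^ d"
    by (intro card_families_bounded_intersection) (auto simp: a_def b_def)
  moreover have "inj_on a X" "inj_on b Y"
    using red M unfolding reduced_on_def inj_on_def by metis+
  ultimately show ?thesis by (simp add: card_image)
qed

section \<open>Extensions of a reduced submatrix\<close>

definition admissible :: "bmatrix \<Rightarrow> nat set \<Rightarrow> nat set \<Rightarrow> nat set \<times> nat set \<Rightarrow> bool" where
  "admissible M X Y c \<longleftrightarrow>
     fst c \<inter> X = {} \<and> snd c \<inter> Y = {} \<and> reduced_on M (X \<union> fst c) (Y \<union> snd c)"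

definition bad_pairs :: "bmatrix \<Rightarrow> nat set \<Rightarrow> nat set \<Rightarrow> (nat \<times> nat) set" where
  "bad_pairs M X Y = {(i, j). admissible M X Y ({i}, {}) \<or> admissible M X Y ({}, {j}) \<or>
     admissible M X Y ({i}, {j})}"

text \<open>If row \<open>i\<close> were new on \<open>Y\<close>, adding it alone would be
  admissible, so it has a twin \<open>x\<close> in \<open>X\<close>; likewise column
  \<open>j\<close> has a twin \<open>y\<close>. If the entries at \<open>(i, j)\<close> and
  \<open>(x, y)\<close> differed, column \<open>j\<close> would separate row \<open>i\<close> from
  \<open>x\<close> and row \<open>i\<close> would separate column \<open>j\<close> from
  \<open>y\<close>, so both could be added together.\<close>

lemma not_bad_pair:
  assumes red: "reduced_on M X Y" and nb: "(i, j) \<notin> bad_pairs M X Y"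
  obtains x y where "x \<in> X" "y \<in> Y" "\<forall>y'\<in>Y. M i y' = M x y'" "\<forall>x'\<in>X. M x' j = M x' y"
    "M i j = M x y"
proof -
  have R: "\<And>x x'. x \<in> X \<Longrightarrow> x' \<in> X \<Longrightarrow> (\<forall>y\<in>Y. M x y = M x' y) \<Longrightarrow> x = x'"
    and C: "\<And>y y'. y \<in> Y \<Longrightarrow> y' \<in> Y \<Longrightarrow> (\<forall>x\<in>X. M x y = M x y') \<Longrightarrow> y = y'"
    using red unfolding reduced_on_def by blast+
  have n1: "\<not> admissible M X Y ({i}, {})" and n2: "\<not> admissible M X Y ({}, {j})"
    and n3: "\<not> admissible M X Y ({i}, {j})"
    using nb by (auto simp: bad_pairs_def)
  have "\<exists>x\<in>X. \<forall>y'\<in>Y. M i y' = M x y'"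
  proof (rule ccontr)
    assume no: "\<not> ?thesis"
    then have "i \<notin> X" by auto
    moreover have "reduced_on M (X \<union> {i}) Y"
    proof -
      have "x1 \<noteq> i \<Longrightarrow> x1 \<in> X" "x2 \<noteq> i \<Longrightarrow> x2 \<in> X"
        if "x1 \<in> X \<union> {i}" "x2 \<in> X \<union> {i}" for x1 x2 using that by auto
      then have "x1 = x2" if "x1 \<in> X \<union> {i}" "x2 \<in> X \<union> {i}" "\<forall>y\<in>Y. M x1 y = M x2 y" for x1 x2
        using that no R[of x1 x2] by metis
      then show ?thesis unfolding reduced_on_def using C by blast
    qed
    ultimately show False using n1 by (simp add: admissible_def)
  qed
  then obtain x where x: "x \<in> X" "\<forall>y'\<in>Y. M i y' = M x y'" by auto
  have "\<exists>y\<in>Y. \<forall>x'\<in>X. M x' j = M x' y"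
  proof (rule ccontr)
    assume no: "\<not> ?thesis"
    then have "j \<notin> Y" by auto
    moreover have "reduced_on M X (Y \<union> {j})"
    proof -
      have "y1 \<noteq> j \<Longrightarrow> y1 \<in> Y" "y2 \<noteq> j \<Longrightarrow> y2 \<in> Y"
        if "y1 \<in> Y \<union> {j}" "y2 \<in> Y \<union> {j}" for y1 y2 using that by auto
      then have "y1 = y2" if "y1 \<in> Y \<union> {j}" "y2 \<in> Y \<union> {j}" "\<forall>x\<in>X. M x y1 = M x y2" for y1 y2
        using that no C[of y1 y2] by metis
      then show ?thesis unfolding reduced_on_def using R by blast
    qed
    ultimately show False using n2 by (simp add: admissible_def)
  qed
  then obtain y where y: "y \<in> Y" "\<forall>x'\<in>X. M x' j = M x' y" by auto
  have "M i j = M x y"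
  proof (rule ccontr)
    assume ne: "M i j \<noteq> M x y"
    \<comment> \<open>A row of \<open>X\<close> is its own only twin, and \<open>i = x\<close> would
      force the two entries to agree.\<close>
    have "i \<notin> X" using R[of i x] x y ne by auto
    moreover have "j \<notin> Y" using C[of j y] x y ne by auto
    moreover have "reduced_on M (X \<union> {i}) (Y \<union> {j})"
    proof -
      have a: "x1 = i" if "x1 \<in> X" "\<forall>y\<in>Y \<union> {j}. M x1 y = M i y" for x1
        using that R[of x1 x] x y ne by auto
      have b: "y1 = j" if "y1 \<in> Y" "\<forall>x\<in>X \<union> {i}. M x y1 = M x j" for y1
        using that C[of y1 y] x y ne by auto
      have a': "i = x1" if "x1 \<in> X" "\<forall>y\<in>Y \<union> {j}. M i y = M x1 y" for x1
        using a[of x1] that by auto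
      have b': "j = y1" if "y1 \<in> Y" "\<forall>x\<in>X \<union> {i}. M x j = M x y1" for y1
        using b[of y1] that by auto
      have R': "x1 = x2" if "x1 \<in> X \<union> {i}" "x2 \<in> X \<union> {i}" "\<forall>y\<in>Y \<union> {j}. M x1 y = M x2 y" for x1 x2
        using that a[of x1] a'[of x2] R[of x1 x2] by auto
      have C': "y1 = y2" if "y1 \<in> Y \<union> {j}" "y2 \<in> Y \<union> {j}" "\<forall>x\<in>X \<union> {i}. M x y1 = M x y2" for y1 y2
        using that b[of y1] b'[of y2] C[of y1 y2] by auto
      show ?thesis unfolding reduced_on_def using R' C' by blast
    qed
    ultimately show False using n3 by (simp add: admissible_def)
  qed
  then show ?thesis using that x y by blast
qed

text \<open>Copying the entries of a reduced submatrix along rows and columns with equal patterns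
  preserves covers; the copy can differ from the matrix in bad pairs only.\<close>

lemma card_bad_pairs_gt:
  assumes s: "1 \<le> s" and red: "reduced_on M X Y" and cov: "cover_on s X Y M d"
    and far: "eps_far (\<lambda>M. sbrank s n m M \<le> d) eps n m M"
  shows "real (card (bad_pairs M X Y \<inter> {..<n} \<times> {..<m})) > eps * real n * real m"
proof -
  have R: "\<And>x x'. x \<in> X \<Longrightarrow> x' \<in> X \<Longrightarrow> (\<forall>y\<in>Y. M x y = M x' y) \<Longrightarrow> x = x'"
    and C: "\<And>y y'. y \<in> Y \<Longrightarrow> y' \<in> Y \<Longrightarrow> (\<forall>x\<in>X. M x y = M x y') \<Longrightarrow> y = y'"
    using red unfolding reduced_on_def by blast+
  \<comment> \<open>The twin relations \<open>r\<close> and \<open>c\<close> are partial functions.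
    Where a twin is missing, the copy \<open>B\<close> is 0, and the pair is bad anyway.\<close>
  define r where "r = (\<lambda>i x. x \<in> X \<and> (\<forall>y'\<in>Y. M i y' = M x y'))"
  define c where "c = (\<lambda>j y. y \<in> Y \<and> (\<forall>x'\<in>X. M x' j = M x' y))"
  have r: "x = x'" if "r i x" "r i x'" for i x x'
    using that R[of x x'] by (auto simp: r_def)
  have c: "y = y'" if "c j y" "c j y'" for j y y'
    using that C[of y y'] by (auto simp: c_def)
  define B where "B = (\<lambda>i j. \<exists>x y. r i x \<and> c j y \<and> M x y)"
  obtain I J where
    1: "\<forall>k<d. I k \<subseteq> X \<and> J k \<subseteq> Y \<and> (\<forall>i\<in>I k. \<forall>j\<in>J k. M i j)" and
    2: "\<forall>i\<in>X. \<forall>j\<in>Y. M i j \<longrightarrow>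
            1 \<le> card {k. k < d \<and> i \<in> I k \<and> j \<in> J k} \<and>
            card {k. k < d \<and> i \<in> I k \<and> j \<in> J k} \<le> s"
    using cov unfolding cover_on_def by auto
  define I' where "I' = (\<lambda>k. {i. i < n \<and> (\<exists>x\<in>I k. r i x)})"
  define J' where "J' = (\<lambda>k. {j. j < m \<and> (\<exists>y\<in>J k. c j y)})"
  have "cover_on s {..<n} {..<m} B d" unfolding cover_on_def
  proof (rule exI[of _ I'], rule exI[of _ J'], rule conjI)
    show "\<forall>k<d. I' k \<subseteq> {..<n} \<and> J' k \<subseteq> {..<m} \<and> (\<forall>i\<in>I' k. \<forall>j\<in>J' k. B i j)"
      using 1 unfolding I'_def J'_def B_def by blast
    show "\<forall>i\<in>{..<n}. \<forall>j\<in>{..<m}. B i j \<longrightarrow>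
            1 \<le> card {k. k < d \<and> i \<in> I' k \<and> j \<in> J' k} \<and>
            card {k. k < d \<and> i \<in> I' k \<and> j \<in> J' k} \<le> s"
    proof (intro ballI impI)
      fix i j assume ij: "i \<in> {..<n}" "j \<in> {..<m}" "B i j"
      then obtain x y where xy: "r i x" "c j y" "M x y" by (auto simp: B_def)
      \<comment> \<open>Twins are unique, so \<open>(i, j)\<close> lies in exactly the rectangles of
        its image \<open>(x, y)\<close>, and the multiplicity bound \<open>s\<close> carries
        over.\<close>
      then have "{k. k < d \<and> i \<in> I' k \<and> j \<in> J' k} = {k. k < d \<and> x \<in> I k \<and> y \<in> J k}"
        using ij r c by (auto simp: I'_def J'_def) metis+
      moreover have "x \<in> X" "y \<in> Y" using xy by (auto simp: r_def c_def)
      ultimately show "1 \<le> card {k. k < d \<and> i \<in> I' k \<and> j \<in> J' k} \<and>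
            card {k. k < d \<and> i \<in> I' k \<and> j \<in> J' k} \<le> s" using 2 xy by auto
    qed
  qed
  then have "sbrank s n m B \<le> d" by (simp add: sbrank_le_iff[OF s])
  then have "eps * real n * real m < real (mat_dist n m M B)"
    using far by (simp add: eps_far_def)
  moreover have "mat_dist n m M B \<le> card (bad_pairs M X Y \<inter> {..<n} \<times> {..<m})"
    unfolding mat_dist_def
  proof (rule card_mono)
    show "{(i, j). i < n \<and> j < m \<and> M i j \<noteq> B i j} \<subseteq> bad_pairs M X Y \<inter> {..<n} \<times> {..<m}"
    proof clarify
      fix i j assume ij: "i < n" "j < m" "M i j \<noteq> B i j"
      have "(i, j) \<in> bad_pairs M X Y"
      proof (rule ccontr)
        assume "(i, j) \<notin> bad_pairs M X Y"
        then obtain x y where "r i x" "c j y" "M i j = M x y"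
          using not_bad_pair[OF red, of i j] by (metis c_def r_def)
        then show False using ij r c unfolding B_def by metis
      qed
      then show "(i, j) \<in> bad_pairs M X Y \<inter> {..<n} \<times> {..<m}" using ij by auto
    qed
  qed auto
  ultimately show ?thesis by linarith
qed

section \<open>Decision trees\<close>

primrec query_list :: "(nat \<times> nat) list \<Rightarrow> bmatrix \<Rightarrow> (bmatrix \<Rightarrow> qtree) \<Rightarrow> qtree" where
  "query_list [] N f = f N"
| "query_list (q # qs) N f =
     Query q (\<lambda>b. query_list qs (N(fst q := (N (fst q))(snd q := b))) f)"

lemma run_query_list:
  "run (query_list qs N f) M = run (f (\<lambda>i j. if (i, j) \<in> set qs then M i j else N i j)) M"
proof (induction qs arbitrary: N)
  case (Cons q qs)
  have "(\<lambda>i j. if (i, j) \<in> set qs then M i j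
          else (N(fst q := (N (fst q))(snd q := M (fst q) (snd q)))) i j) =
        (\<lambda>i j. if (i, j) \<in> set (q # qs) then M i j else N i j)"
    by (intro ext) (cases q, auto)
  then show ?case by (simp only: query_list.simps run.simps Cons.IH)
qed simp

lemma depth_query_list:
  assumes "\<And>N'. depth (f N') \<le> D"
  shows "depth (query_list qs N f) \<le> length qs + D"
  by (induction qs arbitrary: N) (use assms in auto)

lemma queries_query_list:
  assumes "\<And>N'. queries (f N') \<subseteq> Q"
  shows "queries (query_list qs N f) \<subseteq> set qs \<union> Q"
proof (induction qs arbitrary: N)
  case (Cons q qs)
  show ?case using Cons.IH by simp blast
qed (use assms in auto)

text \<open>The enumeration is arbitrary; its distinctness is what makes the number of queries equal
  to \<open>card S\<close>.\<close>

definition query_set :: "(nat \<times> nat) set \<Rightarrow> bmatrix \<Rightarrow> (bmatrix \<Rightarrow> qtree) \<Rightarrow> qtree" where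
  "query_set S = query_list (SOME qs. set qs = S \<and> distinct qs)"

lemma query_set_eq_query_list:
  assumes "finite S"
  obtains qs where "set qs = S" "length qs = card S" "query_set S = query_list qs"
proof -
  have "\<exists>qs. set qs = S \<and> distinct qs" using assms by (rule finite_distinct_list)
  then have "set (SOME qs. set qs = S \<and> distinct qs) = S \<and>
      distinct (SOME qs. set qs = S \<and> distinct qs)"
    by (rule someI_ex)
  then show ?thesis
    by (intro that[of "SOME qs. set qs = S \<and> distinct qs"])
      (simp_all add: query_set_def flip: distinct_card)
qed

lemma run_query_set:
  assumes "finite S"
  shows "run (query_set S N f) M = run (f (\<lambda>i j. if (i, j) \<in> S then M i j else N i j)) M"
  by (rule query_set_eq_query_list[OF assms]) (simp only: run_query_list)

lemma depth_query_set:
  assumes "finite S" "\<And>N'. depth (f N') \<le> D"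
  shows "depth (query_set S N f) \<le> card S + D"
proof (rule query_set_eq_query_list[OF assms(1)])
  fix qs assume "length qs = card S" "query_set S = query_list qs"
  then show ?thesis using depth_query_list[of f D qs N, OF assms(2)] by simp
qed

lemma queries_query_set:
  assumes "finite S" "\<And>N'. queries (f N') \<subseteq> Q"
  shows "queries (query_set S N f) \<subseteq> S \<union> Q"
proof (rule query_set_eq_query_list[OF assms(1)])
  fix qs assume "set qs = S" "query_set S = query_list qs"
  then show ?thesis using queries_query_list[of f Q qs N, OF assms(2)] by simp
qed

text \<open>In the trees below, \<open>N\<close> records the answers received so far: it agrees with the queried
  matrix on \<open>X \<times> Y\<close>.\<close>

primrec try_extensions ::
  "(nat set \<times> nat set) list \<Rightarrow> nat set \<Rightarrow> nat set \<Rightarrow> bmatrix \<Rightarrow>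
   (nat set \<Rightarrow> nat set \<Rightarrow> bmatrix \<Rightarrow> qtree) \<Rightarrow> qtree" where
  "try_extensions [] X Y N F = Leaf True"
| "try_extensions (c # cs) X Y N F =
     (if fst c \<inter> X = {} \<and> snd c \<inter> Y = {}
      then query_set ((X \<union> fst c) \<times> (Y \<union> snd c) - X \<times> Y) N
        (\<lambda>N'. if reduced_on N' (X \<union> fst c) (Y \<union> snd c)
              then F (X \<union> fst c) (Y \<union> snd c) N' else try_extensions cs X Y N F)
      else try_extensions cs X Y N F)"

text \<open>The order is by cost: a new row costs \<open>card Y\<close> queries, a new column
  \<open>card X\<close>, and a row together with a column costs more than either.\<close>

definition candidates ::
  "nat set \<Rightarrow> nat set \<Rightarrow> (nat \<times> nat) list \<Rightarrow> (nat set \<times> nat set) list" where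
  "candidates X Y w =
     (let rs = map (\<lambda>(i, j). ({i}, {})) w; cs = map (\<lambda>(i, j). ({}, {j})) w
      in (if card Y \<le> card X then rs @ cs else cs @ rs) @ map (\<lambda>(i, j). ({i}, {j})) w)"

text \<open>All random pairs are drawn in advance, one list \<open>w\<close> per stage, so the tree
  itself is deterministic.\<close>

primrec grow ::
  "nat \<Rightarrow> nat \<Rightarrow> (nat \<times> nat) list list \<Rightarrow> nat set \<Rightarrow> nat set \<Rightarrow> bmatrix \<Rightarrow> qtree" where
  "grow s d [] X Y N = Leaf (cover_on s X Y N d)"
| "grow s d (w # ws) X Y N =
     (if cover_on s X Y N d then try_extensions (candidates X Y w) X Y N (grow s d ws)
      else Leaf False)"

text \<open>The outcome of \<open>grow\<close> on \<open>M\<close>, freed from queries and recorded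
  answers. A stuck stage accepts, so rejection always rests on a submatrix without a cover; this
  makes the error one-sided.\<close>

primrec accepts ::
  "nat \<Rightarrow> nat \<Rightarrow> bmatrix \<Rightarrow> (nat \<times> nat) list list \<Rightarrow> nat set \<Rightarrow> nat set \<Rightarrow> bool" where
  "accepts s d M [] X Y \<longleftrightarrow> cover_on s X Y M d"
| "accepts s d M (w # ws) X Y \<longleftrightarrow> cover_on s X Y M d \<and>
     (case find (admissible M X Y) (candidates X Y w) of None \<Rightarrow> True
      | Some c \<Rightarrow> accepts s d M ws (X \<union> fst c) (Y \<union> snd c))"

section \<open>Outcome of the decision trees\<close>

lemma set_candidates:
  "set (candidates X Y w) = (\<Union>(i, j)\<in>set w. {({i}, {}), ({}, {j}), ({i}, {j})})"
  by (auto simp: candidates_def Let_def)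

lemma length_candidates: "length (candidates X Y w) = 3 * length w"
  by (simp add: candidates_def Let_def)

lemma finite_candidate:
  "c \<in> set (candidates X Y w) \<Longrightarrow> finite (fst c) \<and> finite (snd c)"
  by (auto simp: set_candidates)

text \<open>Querying the new entries restores the agreement with \<open>M\<close> on the extended
  submatrix. After a failed candidate the search resumes with the old record \<open>N\<close>, which
  still agrees on \<open>X\<close> and \<open>Y\<close>.\<close>

lemma run_try_extensions:
  assumes fin: "finite X" "finite Y"
    and agree: "\<And>i j. i \<in> X \<Longrightarrow> j \<in> Y \<Longrightarrow> N i j = M i j"
    and cs: "\<And>c. c \<in> set cs \<Longrightarrow> finite (fst c) \<and> finite (snd c)"
    and F: "\<And>X' Y' N'. finite X' \<Longrightarrow> finite Y' \<Longrightarrow>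
      (\<And>i j. i \<in> X' \<Longrightarrow> j \<in> Y' \<Longrightarrow> N' i j = M i j) \<Longrightarrow> run (F X' Y' N') M = R X' Y'"
  shows "run (try_extensions cs X Y N F) M =
    (case find (admissible M X Y) cs of None \<Rightarrow> True | Some c \<Rightarrow> R (X \<union> fst c) (Y \<union> snd c))"
  using cs
proof (induction cs)
  case (Cons c cs)
  have IH: "run (try_extensions cs X Y N F) M =
    (case find (admissible M X Y) cs of None \<Rightarrow> True | Some c \<Rightarrow> R (X \<union> fst c) (Y \<union> snd c))"
    using Cons by simp
  let ?X = "X \<union> fst c" and ?Y = "Y \<union> snd c"
  have f: "finite ?X" "finite ?Y" using fin Cons.prems[of c] by auto
  show ?case
  proof (cases "fst c \<inter> X = {} \<and> snd c \<inter> Y = {}")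
    case True
    define N' where "N' = (\<lambda>i j. if (i, j) \<in> ?X \<times> ?Y - X \<times> Y then M i j else N i j)"
    have N': "N' i j = M i j" if "i \<in> ?X" "j \<in> ?Y" for i j
      using that agree by (auto simp: N'_def)
    have red: "reduced_on N' ?X ?Y = reduced_on M ?X ?Y" using N' by (rule reduced_on_cong)
    have "finite (?X \<times> ?Y - X \<times> Y)" using f by simp
    then have "run (try_extensions (c # cs) X Y N F) M =
      run (if reduced_on N' ?X ?Y then F ?X ?Y N' else try_extensions cs X Y N F) M"
      unfolding try_extensions.simps using True by (simp only: simp_thms if_True run_query_set N'_def)
    moreover have "admissible M X Y c = reduced_on M ?X ?Y"
      using True by (simp add: admissible_def)
    ultimately show ?thesis using red IH F[OF f N'] by simp
  next
    case False
    then have "try_extensions (c # cs) X Y N F = try_extensions cs X Y N F"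
      by (simp only: try_extensions.simps if_False)
    moreover have "\<not> admissible M X Y c" using False by (auto simp: admissible_def)
    ultimately show ?thesis using IH by simp
  qed
qed simp

lemma run_grow:
  assumes "finite X" "finite Y" "\<And>i j. i \<in> X \<Longrightarrow> j \<in> Y \<Longrightarrow> N i j = M i j"
  shows "run (grow s d ws X Y N) M = accepts s d M ws X Y"
  using assms
proof (induction ws arbitrary: X Y N)
  case Nil
  then show ?case using cover_on_cong[of X Y N M] by simp
next
  case (Cons w ws)
  have cov: "cover_on s X Y N d = cover_on s X Y M d"
    using Cons.prems(3) by (rule cover_on_cong)
  have "run (try_extensions (candidates X Y w) X Y N (grow s d ws)) M =
    (case find (admissible M X Y) (candidates X Y w) of None \<Rightarrow> True
      | Some c \<Rightarrow> accepts s d M ws (X \<union> fst c) (Y \<union> snd c))"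
    using Cons.prems finite_candidate Cons.IH by (rule run_try_extensions)
  then show ?case using cov by simp
qed

text \<open>All submatrices reached stay inside \<open>Z\<close> and \<open>W\<close> and inherit
  the cover, so no test for a cover ever fails.\<close>

lemma accepts_if_cover:
  assumes "cover_on s Z W M d" "X \<subseteq> Z" "Y \<subseteq> W" "\<forall>w\<in>set ws. set w \<subseteq> Z \<times> W"
  shows "accepts s d M ws X Y"
  using assms(2-)
proof (induction ws arbitrary: X Y)
  case Nil
  then show ?case using cover_on_submatrix[OF assms(1)] by simp
next
  case (Cons w ws)
  have "accepts s d M ws (X \<union> fst c) (Y \<union> snd c)"
    if "find (admissible M X Y) (candidates X Y w) = Some c" for c
  proof (rule Cons.IH)
    have "c \<in> set (candidates X Y w)" using that by (auto simp: find_Some_iff)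
    then show "X \<union> fst c \<subseteq> Z" "Y \<union> snd c \<subseteq> W"
      using Cons.prems by (auto simp: set_candidates)
  qed (use Cons.prems in auto)
  then show ?case using cover_on_submatrix[OF assms(1)] Cons.prems by (auto split: option.split)
qed

section \<open>Number of queries\<close>

definition extension_cost :: "nat set \<Rightarrow> nat set \<Rightarrow> nat set \<times> nat set \<Rightarrow> nat" where
  "extension_cost X Y c =
     card (fst c) * card Y + card (snd c) * card X + card (fst c) * card (snd c)"

text \<open>The same number measures the growth of the submatrix and the queries spent on it; this
  is the basis of the amortised count in \<open>depth_grow\<close>.\<close>

lemma card_extension:
  assumes "finite X" "finite Y" "finite (fst c)" "finite (snd c)"
    and "fst c \<inter> X = {}" "snd c \<inter> Y = {}"
  shows "card (X \<union> fst c) * card (Y \<union> snd c) = card X * card Y + extension_cost X Y c"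
    and "card ((X \<union> fst c) \<times> (Y \<union> snd c) - X \<times> Y) = extension_cost X Y c"
proof -
  have "card (X \<union> fst c) = card X + card (fst c)" "card (Y \<union> snd c) = card Y + card (snd c)"
    using assms by (simp_all add: card_Un_disjoint Int_commute)
  then show 1: "card (X \<union> fst c) * card (Y \<union> snd c) = card X * card Y + extension_cost X Y c"
    by (simp add: extension_cost_def algebra_simps)
  have "card ((X \<union> fst c) \<times> (Y \<union> snd c) - X \<times> Y) =
      card ((X \<union> fst c) \<times> (Y \<union> snd c)) - card (X \<times> Y)"
    by (rule card_Diff_subset) (use assms in auto)
  then show "card ((X \<union> fst c) \<times> (Y \<union> snd c) - X \<times> Y) = extension_cost X Y c"
    using 1 by (simp add: card_cartesian_product)
qed

text \<open>In sorted order, every candidate that fails before \<open>c\<close> costs at most as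
  much as \<open>c\<close>, so success at \<open>c\<close> costs at most \<open>length cs\<close>
  times its own cost. The budget \<open>G\<close> also has to cover the case that all candidates
  fail.\<close>

lemma depth_try_extensions:
  assumes fin: "finite X" "finite Y"
    and "\<And>c. c \<in> set cs \<Longrightarrow> finite (fst c) \<and> finite (snd c)"
    and "sorted_wrt (\<lambda>c c'. extension_cost X Y c \<le> extension_cost X Y c') cs"
    and "\<And>c. c \<in> set cs \<Longrightarrow> length cs * extension_cost X Y c \<le> G"
    and "\<And>c N'. c \<in> set cs \<Longrightarrow> fst c \<inter> X = {} \<Longrightarrow> snd c \<inter> Y = {} \<Longrightarrow>
      reduced_on N' (X \<union> fst c) (Y \<union> snd c) \<Longrightarrow>
      depth (F (X \<union> fst c) (Y \<union> snd c) N') + length cs * extension_cost X Y c \<le> G"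
  shows "depth (try_extensions cs X Y N F) \<le> G"
  using assms(3-)
proof (induction cs arbitrary: G)
  case (Cons c cs)
  let ?e = "extension_cost X Y"
  have le: "?e c + length cs * ?e c \<le> G" using Cons.prems(3)[of c] by simp
  have mono: "?e c \<le> ?e c'" if "c' \<in> set cs" for c' using Cons.prems(2) that by simp
  \<comment> \<open>A later candidate reserves one more copy of its own cost than the shorter list
    needs, and that copy pays for \<open>c\<close>.\<close>
  have IH: "depth (try_extensions cs X Y N F) \<le> G - ?e c"
  proof (rule Cons.IH)
    show "finite (fst c') \<and> finite (snd c')" if "c' \<in> set cs" for c'
      using Cons.prems(1) that by simp
    show "sorted_wrt (\<lambda>c c'. ?e c \<le> ?e c') cs" using Cons.prems(2) by simp
    show "length cs * ?e c' \<le> G - ?e c" if "c' \<in> set cs" for c'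
      using Cons.prems(3)[of c'] mono[OF that] that by simp
    show "depth (F (X \<union> fst c') (Y \<union> snd c') N') + length cs * ?e c' \<le> G - ?e c"
      if "c' \<in> set cs" "fst c' \<inter> X = {}" "snd c' \<inter> Y = {}"
        "reduced_on N' (X \<union> fst c') (Y \<union> snd c')" for c' N'
      using Cons.prems(4)[of c' N'] mono[OF that(1)] that by simp
  qed
  show ?case
  proof (cases "fst c \<inter> X = {} \<and> snd c \<inter> Y = {}")
    case True
    let ?S = "(X \<union> fst c) \<times> (Y \<union> snd c) - X \<times> Y"
    have finc: "finite (fst c)" "finite (snd c)" using Cons.prems(1)[of c] by auto
    have "depth (query_set ?S N (\<lambda>N'. if reduced_on N' (X \<union> fst c) (Y \<union> snd c)
              then F (X \<union> fst c) (Y \<union> snd c) N' else try_extensions cs X Y N F))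
          \<le> card ?S + (G - ?e c)"
    proof (rule depth_query_set)
      show "finite ?S" using fin finc by simp
      show "depth (if reduced_on N' (X \<union> fst c) (Y \<union> snd c)
              then F (X \<union> fst c) (Y \<union> snd c) N' else try_extensions cs X Y N F) \<le> G - ?e c" for N'
        using IH Cons.prems(4)[of c N'] True by fastforce
    qed
    moreover have "card ?S = ?e c" using card_extension(2)[OF fin finc] True by simp
    ultimately show ?thesis using True le by simp
  next
    case False
    then have "try_extensions (c # cs) X Y N F = try_extensions cs X Y N F"
      by (simp only: try_extensions.simps if_False)
    then show ?thesis using IH by simp
  qed
qed simp

lemma sorted_candidates:
  "sorted_wrt (\<lambda>c c'. extension_cost X Y c \<le> extension_cost X Y c') (candidates X Y w)"
proof -
  \<comment> \<open>Within each of the three blocks all costs are equal, so the order relation on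
    \<open>w\<close> reduces to \<open>True\<close>.\<close>
  have "sorted_wrt (\<lambda>_ _. True) w" by (simp add: sorted_wrt_iff_nth_less)
  then show ?thesis
    by (auto simp: candidates_def Let_def sorted_wrt_append sorted_wrt_map extension_cost_def
        split_def)
qed

lemma extension_cost_candidate_le:
  "c \<in> set (candidates X Y w) \<Longrightarrow> extension_cost X Y c \<le> card X + card Y + 1"
  by (auto simp: set_candidates extension_cost_def)

lemma add_le_mult_Suc:
  fixes a b :: nat
  assumes "1 \<le> a" "1 \<le> b"
  shows "a + b \<le> a * b + 1"
proof -
  obtain p q where "a = Suc p" "b = Suc q" using assms by (metis Suc_le_D One_nat_def)
  then show ?thesis by simp
qed

text \<open>The potential \<open>3 * K - card X * card Y\<close> drops by the cost of each
  successful extension, and a stage with \<open>3 * L\<close> candidates costs at most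
  \<open>3 * L\<close> times that drop. The factor 3 leaves room for the last step: extension starts
  from at most \<open>K\<close> entries and adds at most \<open>2 * K\<close>.\<close>

lemma depth_grow:
  fixes d s :: nat
  defines "K \<equiv> binom_le d s * 2 ^ d"
  assumes d: "1 \<le> d"
    and "finite X" "finite Y" "X \<noteq> {}" "Y \<noteq> {}" "reduced_on N X Y" "\<forall>w\<in>set ws. length w = L"
  shows "depth (grow s d ws X Y N) \<le> 3 * L * (3 * K - card X * card Y)"
  using assms(3-)
proof (induction ws arbitrary: X Y N)
  case (Cons w ws)
  note fin = Cons.prems(1,2)
  let ?e = "extension_cost X Y" and ?P = "card X * card Y"
  \<comment> \<open>The bound \<open>K + 2\<close> on the cost of an extension is at most
    \<open>2 * K\<close> only if \<open>K\<close> is at least 2.\<close>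
  have "(2::nat) ^ 1 \<le> 2 ^ d" using d by (rule power_increasing) simp
  then have "1 * 2 \<le> K" unfolding K_def by (intro mult_mono binom_le_pos) simp_all
  then have K2: "2 \<le> K" by simp
  show ?case
  proof (cases "cover_on s X Y N d")
    case True
    then have P: "?P \<le> K" using card_reduced_on_le Cons.prems(5) by (simp add: K_def)
    have "1 \<le> card X" "1 \<le> card Y" using Cons.prems by (simp_all add: Suc_le_eq card_gt_0_iff)
    then have sum: "card X + card Y \<le> ?P + 1" by (rule add_le_mult_Suc)
    have e: "?e c \<le> 2 * K" if "c \<in> set (candidates X Y w)" for c
      using extension_cost_candidate_le[OF that] sum P K2 by linarith
    have len: "length (candidates X Y w) = 3 * L" using Cons.prems by (simp add: length_candidates)
    have "depth (try_extensions (candidates X Y w) X Y N (grow s d ws)) \<le> 3 * L * (3 * K - ?P)"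
    proof (rule depth_try_extensions[OF fin finite_candidate sorted_candidates])
      fix c assume c: "c \<in> set (candidates X Y w)"
      show "length (candidates X Y w) * ?e c \<le> 3 * L * (3 * K - ?P)"
        unfolding len by (rule mult_le_mono2) (use e[OF c] P in linarith)
      fix N' assume c': "fst c \<inter> X = {}" "snd c \<inter> Y = {}" and
        red: "reduced_on N' (X \<union> fst c) (Y \<union> snd c)"
      have finc: "finite (fst c)" "finite (snd c)" using finite_candidate[OF c] by auto
      have "depth (grow s d ws (X \<union> fst c) (Y \<union> snd c) N') \<le>
          3 * L * (3 * K - card (X \<union> fst c) * card (Y \<union> snd c))"
        using Cons.prems red finc by (intro Cons.IH) auto
      also have "card (X \<union> fst c) * card (Y \<union> snd c) = ?P + ?e c"
        by (rule card_extension(1)[OF fin finc c'])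
      finally have "depth (grow s d ws (X \<union> fst c) (Y \<union> snd c) N') + 3 * L * ?e c \<le>
          3 * L * (3 * K - (?P + ?e c) + ?e c)" by (simp add: algebra_simps)
      also have "3 * K - (?P + ?e c) + ?e c = 3 * K - ?P" using e[OF c] P by linarith
      finally show "depth (grow s d ws (X \<union> fst c) (Y \<union> snd c) N') +
          length (candidates X Y w) * ?e c \<le> 3 * L * (3 * K - ?P)" by (simp only: len)
    qed
    then show ?thesis using True by simp
  qed simp
qed simp

lemma queries_try_extensions:
  assumes fin: "finite Z" "finite W" and XY: "X \<subseteq> Z" "Y \<subseteq> W"
    and "\<And>c. c \<in> set cs \<Longrightarrow> fst c \<subseteq> Z \<and> snd c \<subseteq> W"
    and F: "\<And>X' Y' N'. X' \<subseteq> Z \<Longrightarrow> Y' \<subseteq> W \<Longrightarrow> queries (F X' Y' N') \<subseteq> Z \<times> W"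
  shows "queries (try_extensions cs X Y N F) \<subseteq> Z \<times> W"
  using assms(5)
proof (induction cs)
  case (Cons c cs)
  let ?X = "X \<union> fst c" and ?Y = "Y \<union> snd c"
  have IH: "queries (try_extensions cs X Y N F) \<subseteq> Z \<times> W" using Cons by simp
  have sub: "?X \<subseteq> Z" "?Y \<subseteq> W" using XY Cons.prems[of c] by auto
  have S: "?X \<times> ?Y - X \<times> Y \<subseteq> Z \<times> W" using sub by blast
  then have "finite (?X \<times> ?Y - X \<times> Y)" by (rule finite_subset) (use fin in simp)
  then have "queries (query_set (?X \<times> ?Y - X \<times> Y) N (\<lambda>N'. if reduced_on N' ?X ?Y
              then F ?X ?Y N' else try_extensions cs X Y N F)) \<subseteq> (?X \<times> ?Y - X \<times> Y) \<union> Z \<times> W"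
    by (rule queries_query_set) (use IH F[OF sub] in simp)
  also have "\<dots> = Z \<times> W" using S by blast
  finally show ?case using IH by (simp only: try_extensions.simps split: if_split) simp
qed simp

lemma queries_grow:
  assumes fin: "finite Z" "finite W" and "X \<subseteq> Z" "Y \<subseteq> W" "\<forall>w\<in>set ws. set w \<subseteq> Z \<times> W"
  shows "queries (grow s d ws X Y N) \<subseteq> Z \<times> W"
  using assms(3-)
proof (induction ws arbitrary: X Y N)
  case (Cons w ws)
  have "queries (try_extensions (candidates X Y w) X Y N (grow s d ws)) \<subseteq> Z \<times> W"
  proof (rule queries_try_extensions[OF fin Cons.prems(1,2)])
    show "fst c \<subseteq> Z \<and> snd c \<subseteq> W" if "c \<in> set (candidates X Y w)" for c
      using that Cons.prems(3) by (auto simp: set_candidates)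
    show "queries (grow s d ws X' Y' N') \<subseteq> Z \<times> W" if "X' \<subseteq> Z" "Y' \<subseteq> W" for X' Y' N'
      using Cons that by simp
  qed
  then show ?case by simp
qed simp

section \<open>Acceptance probability\<close>

text \<open>Used for one stage of a union bound: \<open>A\<close> is the event that the first draw
  is unlucky, and \<open>b\<close> bounds the failure probability of the rest.\<close>

lemma prob_bind_pmf_le:
  assumes "0 \<le> a" "0 \<le> b"
    and le: "\<And>x. x \<in> set_pmf p \<Longrightarrow> measure_pmf.prob (f x) S \<le> a * indicator A x + b"
  shows "measure_pmf.prob (bind_pmf p f) S \<le> a * measure_pmf.prob p A + b"
proof -
  have "ennreal (measure_pmf.prob (bind_pmf p f) S) = (\<integral>\<^sup>+x. emeasure (measure_pmf (f x)) S \<partial>measure_pmf p)"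
    by (simp add: measure_pmf.emeasure_eq_measure[symmetric] emeasure_bind_pmf)
  also have "\<dots> \<le> (\<integral>\<^sup>+x. ennreal a * indicator A x + ennreal b \<partial>measure_pmf p)"
  proof (rule nn_integral_mono_AE, unfold AE_measure_pmf_iff, rule ballI)
    fix x assume "x \<in> set_pmf p"
    then have "ennreal (measure_pmf.prob (f x) S) \<le> ennreal (a * indicator A x + b)"
      by (intro ennreal_leI le)
    also have "\<dots> = ennreal a * indicator A x + ennreal b"
      using assms(1,2) by (simp add: indicator_def)
    finally show "emeasure (measure_pmf (f x)) S \<le> ennreal a * indicator A x + ennreal b"
      by (simp add: measure_pmf.emeasure_eq_measure)
  qed
  also have "\<dots> = ennreal a * emeasure (measure_pmf p) A + ennreal b"
    by (subst nn_integral_add) (simp_all add: nn_integral_cmult)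
  also have "\<dots> = ennreal (a * measure_pmf.prob p A + b)"
    using assms(1,2) by (simp add: measure_pmf.emeasure_eq_measure ennreal_mult)
  finally show ?thesis using assms(1,2) by (subst (asm) ennreal_le_iff) simp_all
qed

lemma prob_replicate_pmf_avoid_le:
  assumes "measure_pmf.prob p (- B) \<le> q"
  shows "measure_pmf.prob (replicate_pmf L p) {w. set w \<inter> B = {}} \<le> q ^ L"
proof (induction L)
  case 0
  then show ?case by simp
next
  case (Suc L)
  have q: "0 \<le> q" using assms measure_nonneg order_trans by blast
  have "measure_pmf.prob (replicate_pmf (Suc L) p) {w. set w \<inter> B = {}}
      \<le> q ^ L * measure_pmf.prob p (- B) + 0"
    unfolding replicate_pmf.simps
  proof (rule prob_bind_pmf_le)
    fix x
    have "measure_pmf.prob (replicate_pmf L p \<bind> (\<lambda>xs. return_pmf (x # xs))) {w. set w \<inter> B = {}} =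
        measure_pmf.prob (replicate_pmf L p) {xs. set (x # xs) \<inter> B = {}}"
      by (simp add: map_pmf_def[symmetric] vimage_def)
    also have "\<dots> \<le> q ^ L * indicator (- B) x + 0"
      using Suc by (cases "x \<in> B") auto
    finally show "measure_pmf.prob (replicate_pmf L p \<bind> (\<lambda>xs. return_pmf (x # xs))) {w. set w \<inter> B = {}}
      \<le> q ^ L * indicator (- B) x + 0" .
  qed (use q in auto)
  also have "\<dots> \<le> q ^ L * q" using assms q by (simp add: mult_left_mono)
  finally show ?case by (simp add: mult.commute)
qed

text \<open>Induction on the number \<open>k\<close> of remaining stages, each getting stuck with
  probability at most \<open>(1 - eps) ^ L\<close>. A submatrix with a cover has
  \<open>card X + card Y\<close> at most \<open>K + 1\<close>, and every stage that is not stuck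
  raises this sum. Hence the last hypothesis ensures that the stages suffice to reach a submatrix
  without a cover.\<close>

lemma prob_accepts_le:
  fixes d s n m :: nat
  defines "K \<equiv> binom_le d s * 2 ^ d"
    and "p \<equiv> pmf_of_set ({..<n} \<times> {..<m})"
  assumes s: "1 \<le> s" and nm: "1 \<le> n" "1 \<le> m" and eps: "eps < 1"
    and far: "eps_far (\<lambda>M. sbrank s n m M \<le> d) eps n m M"
    and "reduced_on M X Y" "finite X" "finite Y" "X \<noteq> {}" "Y \<noteq> {}" "K + 1 < card X + card Y + k"
  shows "measure_pmf.prob (replicate_pmf k (replicate_pmf L p)) {ws. accepts s d M ws X Y}
    \<le> real k * (1 - eps) ^ L"
  using assms(8-)
proof (induction k arbitrary: X Y)
  have stop: "card X + card Y \<le> K + 1"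
    if "reduced_on M X Y" "finite X" "finite Y" "X \<noteq> {}" "Y \<noteq> {}" "cover_on s X Y M d" for X Y
  proof -
    have "1 \<le> card X" "1 \<le> card Y" using that by (simp_all add: Suc_le_eq card_gt_0_iff)
    then have "card X + card Y \<le> card X * card Y + 1" by (rule add_le_mult_Suc)
    then show ?thesis using card_reduced_on_le[OF that(6,1)] by (simp add: K_def)
  qed
  {
    case 0
    then have "\<not> cover_on s X Y M d" using stop[of X Y] by auto
    then show ?case by simp
  next
    case (Suc k)
    define q where "q = (1 - eps) ^ L"
    have q: "0 \<le> q" using eps by (simp add: q_def)
    show ?case
    proof (cases "cover_on s X Y M d")
      case False
      have "measure_pmf.prob (replicate_pmf (Suc k) (replicate_pmf L p)) {ws. accepts s d M ws X Y}
          \<le> 0 * measure_pmf.prob (replicate_pmf L p) {} + 0"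
        unfolding replicate_pmf.simps
        by (rule prob_bind_pmf_le) (simp_all add: map_pmf_def[symmetric] vimage_def False)
      also have "\<dots> \<le> real (Suc k) * (1 - eps) ^ L" using q by (simp add: q_def)
      finally show ?thesis .
    next
      case True
      let ?B = "bad_pairs M X Y" and ?D = "{..<n} \<times> {..<m}"
      let ?A = "{w. set w \<inter> ?B = {}}"
      have D: "finite ?D" "?D \<noteq> {}" using nm by (auto simp: lessThan_empty_iff)
      have compl: "measure_pmf.prob p (- ?B) = 1 - measure_pmf.prob p ?B"
        using measure_pmf.prob_compl[of ?B p] by (simp add: Compl_eq_Diff_UNIV)
      have "eps \<le> real (card (?B \<inter> ?D)) / (real n * real m)"
        using card_bad_pairs_gt[OF s Suc.prems(1) True far] nm
        by (simp add: field_simps)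
      also have "\<dots> = measure_pmf.prob p ?B"
        unfolding p_def using D by (simp add: measure_pmf_of_set Int_commute)
      finally have "measure_pmf.prob p (- ?B) \<le> 1 - eps" using compl by simp
      then have A: "measure_pmf.prob (replicate_pmf L p) ?A \<le> q"
        unfolding q_def by (rule prob_replicate_pmf_avoid_le)
      have "measure_pmf.prob (replicate_pmf (Suc k) (replicate_pmf L p)) {ws. accepts s d M ws X Y}
          \<le> 1 * measure_pmf.prob (replicate_pmf L p) ?A + real k * q"
        unfolding replicate_pmf.simps
      proof (rule prob_bind_pmf_le)
        fix w
        let ?pr = "measure_pmf.prob (replicate_pmf k (replicate_pmf L p))"
        have "?pr {ws. accepts s d M (w # ws) X Y} \<le> 1 * indicator ?A w + real k * q"
        proof (cases "w \<in> ?A")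
          case True
          have "?pr {ws. accepts s d M (w # ws) X Y} \<le> 1" by simp
          also have "\<dots> \<le> 1 * indicator ?A w + real k * q" using True q by simp
          finally show ?thesis .
        next
          case False
          then obtain i j where ij: "(i, j) \<in> set w" "(i, j) \<in> ?B" by auto
          \<comment> \<open>A sampled bad pair guarantees some admissible candidate. The one found
            may come from another pair, but it too adds a row or a column.\<close>
          then have "\<exists>c\<in>set (candidates X Y w). admissible M X Y c"
            by (fastforce simp: set_candidates bad_pairs_def)
          then obtain c where find: "find (admissible M X Y) (candidates X Y w) = Some c"
            by (metis find_None_iff not_None_eq)
          then have c: "c \<in> set (candidates X Y w)" and adm: "admissible M X Y c"
            by (auto simp: find_Some_iff)
          have finc: "finite (fst c)" "finite (snd c)" using finite_candidate[OF c] by auto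
          have "card (X \<union> fst c) = card X + card (fst c)" "card (Y \<union> snd c) = card Y + card (snd c)"
            using adm finc Suc.prems by (simp_all add: card_Un_disjoint Int_commute admissible_def)
          moreover have "1 \<le> card (fst c) + card (snd c)" using c by (auto simp: set_candidates)
          ultimately have "?pr {ws. accepts s d M ws (X \<union> fst c) (Y \<union> snd c)} \<le> real k * q"
            unfolding q_def using Suc.prems finc adm
            by (intro Suc.IH) (auto simp: admissible_def)
          then show ?thesis using find True False by simp
        qed
        then show "measure_pmf.prob (replicate_pmf k (replicate_pmf L p) \<bind>
            (\<lambda>xs. return_pmf (w # xs))) {ws. accepts s d M ws X Y}
          \<le> 1 * indicator ?A w + real k * q"
          by (simp add: map_pmf_def[symmetric] vimage_def)
      qed (use q in auto)
      also have "\<dots> \<le> real (Suc k) * q" using A by (simp add: algebra_simps)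
      finally show ?thesis by (simp add: q_def)
    qed
  }
qed

section \<open>The testers\<close>

text \<open>With \<open>4 * d / eps\<close> trials a stage gets stuck with probability at most
  \<open>exp (- 4 * d)\<close>, hence at most \<open>1 / 16 ^ d\<close>. Over at most
  \<open>4 ^ d\<close> stages this sums to at most \<open>1 / 4\<close>.\<close>

definition stage_trials :: "real \<Rightarrow> nat \<Rightarrow> nat" where
  "stage_trials eps d = nat \<lceil>4 * real d / eps\<rceil>"

text \<open>The first query makes the constant record \<open>b\<close> agree with the matrix on the
  starting submatrix, a single entry and hence reduced.\<close>

definition rank_le_tester :: "real \<Rightarrow> nat \<Rightarrow> nat \<Rightarrow> nat \<Rightarrow> nat \<Rightarrow> qtree pmf" where
  "rank_le_tester eps d s n m =
     map_pmf (\<lambda>ws. Query (0, 0) (\<lambda>b. grow s d ws {0} {0} (\<lambda>_ _. b)))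
       (replicate_pmf (binom_le d s * 2 ^ d)
         (replicate_pmf (stage_trials eps d) (pmf_of_set ({..<n} \<times> {..<m}))))"

lemma set_rank_le_tester:
  assumes "1 \<le> n" "1 \<le> m" "t \<in> set_pmf (rank_le_tester eps d s n m)"
  obtains ws where "t = Query (0, 0) (\<lambda>b. grow s d ws {0} {0} (\<lambda>_ _. b))"
    "\<forall>w\<in>set ws. length w = stage_trials eps d" "\<forall>w\<in>set ws. set w \<subseteq> {..<n} \<times> {..<m}"
proof -
  have "{..<n} \<times> {..<m} \<noteq> {}" "finite ({..<n} \<times> {..<m})"
    using assms(1,2) by (auto simp: lessThan_empty_iff)
  then show ?thesis
    using assms(3) that by (auto simp: rank_le_tester_def set_replicate_pmf set_pmf_of_set)
qed

lemma run_rank_le_tree: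
  "run (Query (0, 0) (\<lambda>b. grow s d ws {0} {0} (\<lambda>_ _. b))) M = accepts s d M ws {0} {0}"
proof -
  have "run (grow s d ws {0} {0} (\<lambda>_ _. M 0 0)) M = accepts s d M ws {0} {0}"
    by (rule run_grow) auto
  then show ?thesis by simp
qed

lemma stage_trials_le:
  assumes "0 < eps" "eps < 1" "1 \<le> d"
  shows "real (stage_trials eps d) \<le> 5 * real d / eps"
proof -
  have "1 \<le> real d / eps" using assms by (simp add: field_simps)
  moreover have "0 \<le> 4 * real d / eps" using assms by simp
  then have "real (stage_trials eps d) \<le> 4 * real d / eps + 1"
    unfolding stage_trials_def by linarith
  moreover have "5 * real d / eps = 4 * real d / eps + real d / eps" by (simp add: field_simps)
  ultimately show ?thesis by linarith
qed

lemma rank_le_tester_queries: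
  assumes "0 < eps" "eps < 1" "1 \<le> d" "1 \<le> n" "1 \<le> m" "t \<in> set_pmf (rank_le_tester eps d s n m)"
  shows "queries t \<subseteq> {..<n} \<times> {..<m}"
    and "real (depth t) \<le> 45 * real d * real (binom_le d s) * 2 ^ d / eps"
proof -
  obtain ws where t: "t = Query (0, 0) (\<lambda>b. grow s d ws {0} {0} (\<lambda>_ _. b))"
    and ws: "\<forall>w\<in>set ws. length w = stage_trials eps d" "\<forall>w\<in>set ws. set w \<subseteq> {..<n} \<times> {..<m}"
    using set_rank_le_tester[OF assms(4-6)] .
  have "queries (grow s d ws {0} {0} (\<lambda>_ _. b)) \<subseteq> {..<n} \<times> {..<m}" for b
    by (rule queries_grow) (use assms ws in auto)
  then show "queries t \<subseteq> {..<n} \<times> {..<m}" using t assms(4,5) by auto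
  let ?L = "stage_trials eps d" and ?K = "binom_le d s * 2 ^ d"
  have "depth (grow s d ws {0} {0} (\<lambda>_ _. b)) \<le> 3 * ?L * (3 * ?K - card {0::nat} * card {0::nat})" for b
    by (rule depth_grow) (use assms ws in \<open>auto simp: reduced_on_def\<close>)
  then have "depth t \<le> 1 + 3 * ?L * (3 * ?K - 1)" using t by simp
  \<comment> \<open>The initial query is absorbed by the entry that the starting submatrix already
    has, because \<open>3 * ?L\<close> is at least 1.\<close>
  also have "\<dots> \<le> 9 * ?L * ?K"
  proof -
    have "0 < 4 * real d / eps" using assms by simp
    then have L: "1 \<le> ?L" unfolding stage_trials_def by linarith
    have K: "1 \<le> ?K" using binom_le_pos[of d s] by simp
    then obtain k where "?K = Suc k" by (metis Suc_le_D One_nat_def)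
    then show ?thesis using L by (simp add: algebra_simps)
  qed
  finally have "real (depth t) \<le> real (9 * ?L * ?K)" by (rule of_nat_mono)
  also have "\<dots> = 9 * real ?K * real ?L" by simp
  also have "\<dots> \<le> 9 * real ?K * (5 * real d / eps)"
    using stage_trials_le[OF assms(1-3)] by (intro mult_left_mono) simp_all
  finally show "real (depth t) \<le> 45 * real d * real (binom_le d s) * 2 ^ d / eps"
    by (simp add: algebra_simps)
qed

lemma rank_le_tester_complete:
  assumes "1 \<le> s" "1 \<le> n" "1 \<le> m" "sbrank s n m M \<le> d"
  shows "measure_pmf.prob (rank_le_tester eps d s n m) {t. run t M} = 1"
proof -
  have "run t M" if elem: "t \<in> set_pmf (rank_le_tester eps d s n m)" for t
  proof -
    obtain ws where t: "t = Query (0, 0) (\<lambda>b. grow s d ws {0} {0} (\<lambda>_ _. b))"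
      and ws: "\<forall>w\<in>set ws. set w \<subseteq> {..<n} \<times> {..<m}"
      using set_rank_le_tester[OF assms(2,3) elem] by metis
    have "accepts s d M ws {0} {0}"
      by (rule accepts_if_cover[of s "{..<n}" "{..<m}"])
        (use assms ws in \<open>auto simp: sbrank_le_iff\<close>)
    then show ?thesis by (simp only: t run_rank_le_tree)
  qed
  then show ?thesis by (subst measure_pmf.prob_eq_1) (auto simp: AE_measure_pmf_iff)
qed

lemma union_bound_le_third:
  assumes "0 < eps" "eps < 1" "1 \<le> d"
  shows "real (binom_le d s * 2 ^ d) * (1 - eps) ^ stage_trials eps d \<le> 1 / 3"
proof -
  let ?L = "stage_trials eps d"
  have "binom_le d s * 2 ^ d \<le> 2 ^ d * 2 ^ d" using binom_le_le_power by (rule mult_le_mono1)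
  also have "\<dots> = (4::nat) ^ d" by (simp flip: power_mult_distrib)
  finally have K: "real (binom_le d s * 2 ^ d) \<le> 4 ^ d" by (metis of_nat_le_iff of_nat_numeral of_nat_power)
  have "4 * real d / eps \<le> real ?L" unfolding stage_trials_def by linarith
  then have L: "4 * real d \<le> real ?L * eps" using assms by (simp add: field_simps)
  have "(1 - eps) ^ ?L \<le> exp (- eps) ^ ?L"
    using assms exp_ge_add_one_self[of "- eps"] by (intro power_mono) auto
  also have "\<dots> = exp (- (real ?L * eps))" by (simp add: exp_of_nat_mult[symmetric])
  also have "\<dots> \<le> exp (- (4 * real d))" using L by simp
  also have "\<dots> = inverse (exp 1 ^ (4 * d))" by (simp add: exp_minus exp_of_nat_mult[symmetric])
  also have "\<dots> \<le> inverse (2 ^ (4 * d))"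
    using exp_ge_add_one_self[of 1] by (intro le_imp_inverse_le power_mono) auto
  also have "\<dots> = inverse (16 ^ d)" by (simp add: power_mult)
  finally have "real (binom_le d s * 2 ^ d) * (1 - eps) ^ ?L \<le> 4 ^ d * inverse (16 ^ d)"
    using K assms by (intro mult_mono) auto
  also have "\<dots> = inverse (4 ^ d)"
  proof -
    have "(16::real) ^ d = 4 ^ d * 4 ^ d" by (simp flip: power_mult_distrib)
    then show ?thesis by simp
  qed
  also have "\<dots> \<le> inverse (4 ^ 1)"
    using assms by (intro le_imp_inverse_le power_increasing) auto
  finally show ?thesis by simp
qed

lemma rank_le_tester_sound:
  assumes "0 < eps" "eps < 1" "1 \<le> d" "1 \<le> s" "1 \<le> n" "1 \<le> m"
    and far: "eps_far (\<lambda>M. sbrank s n m M \<le> d) eps n m M"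
  shows "measure_pmf.prob (rank_le_tester eps d s n m) {t. \<not> run t M} \<ge> 2 / 3"
proof -
  let ?T = "rank_le_tester eps d s n m"
  have "measure_pmf.prob ?T {t. run t M} = measure_pmf.prob (replicate_pmf (binom_le d s * 2 ^ d)
         (replicate_pmf (stage_trials eps d) (pmf_of_set ({..<n} \<times> {..<m}))))
         {ws. accepts s d M ws {0} {0}}"
    unfolding rank_le_tester_def measure_map_pmf vimage_def mem_Collect_eq run_rank_le_tree ..
  also have "\<dots> \<le> real (binom_le d s * 2 ^ d) * (1 - eps) ^ stage_trials eps d"
    \<comment> \<open>From a single entry, \<open>K\<close> stages are enough: the requirement reads
      \<open>K + 1 < 1 + 1 + K\<close>.\<close>
    by (rule prob_accepts_le) (use assms in \<open>auto simp: reduced_on_def\<close>)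
  also have "\<dots> \<le> 1 / 3" by (rule union_bound_le_third[OF assms(1-3)])
  finally have "measure_pmf.prob ?T {t. run t M} \<le> 1 / 3" .
  moreover have "measure_pmf.prob ?T {t. \<not> run t M} = 1 - measure_pmf.prob ?T {t. run t M}"
    using measure_pmf.prob_compl[of "{t. run t M}" ?T] by (simp add: Compl_eq_Diff_UNIV[symmetric] Collect_neg_eq)
  ultimately show ?thesis by simp
qed

section \<open>Rank exactly \<open>d\<close>\<close>

lemma far_from_rank_le:
  assumes "1 \<le> s" "d \<le> n" "d \<le> m" "2 * real d * real d \<le> eps * real n * real m"
    and far: "eps_far (\<lambda>M. sbrank s n m M = d) eps n m M"
  shows "eps_far (\<lambda>M. sbrank s n m M \<le> d) (eps / 2) n m M"
  unfolding eps_far_def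
proof (intro allI impI)
  fix M' assume "sbrank s n m M' \<le> d"
  \<comment> \<open>Passing from rank at most \<open>d\<close> to rank \<open>d\<close> costs
    \<open>d * d\<close> changes, at most half of the distance \<open>eps * n * m\<close>; the other
    half remains for \<open>M'\<close>.\<close>
  then obtain M'' where M'': "sbrank s n m M'' = d" "mat_dist n m M' M'' \<le> d * d"
    using close_to_sbrank_eq[OF assms(1) _ assms(2,3)] by blast
  have "eps * real n * real m < real (mat_dist n m M M'')"
    using far M''(1) by (simp add: eps_far_def)
  also have "\<dots> \<le> real (mat_dist n m M M' + d * d)"
    using mat_dist_triangle[of n m M M'' M'] M''(2) by (intro of_nat_mono) linarith
  finally show "eps / 2 * real n * real m < real (mat_dist n m M M')" using assms(4) by simp
qed

text \<open>If \<open>d > min n m\<close>, no matrix has rank \<open>d\<close>. If \<open>n m\<close> is small, there may be matrices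
  of rank below \<open>d\<close> that are far from rank \<open>d\<close>, but then all entries can be queried.\<close>

definition rank_eq_tester :: "real \<Rightarrow> nat \<Rightarrow> nat \<Rightarrow> nat \<Rightarrow> nat \<Rightarrow> qtree pmf" where
  "rank_eq_tester eps d s n m =
     (if n < d \<or> m < d then return_pmf (Leaf False)
      else if eps * real n * real m \<le> 2 * real d * real d
      then return_pmf (query_set ({..<n} \<times> {..<m}) (\<lambda>_ _. False) (\<lambda>N. Leaf (sbrank s n m N = d)))
      else rank_le_tester (eps / 2) d s n m)"

lemma sbrank_cong:
  assumes "\<And>i j. i < n \<Longrightarrow> j < m \<Longrightarrow> M i j = M' i j"
  shows "sbrank s n m M = sbrank s n m M'"
  unfolding sbrank_def sbr_cover_iff_cover_on
proof -
  have "cover_on s {..<n} {..<m} M d = cover_on s {..<n} {..<m} M' d" for d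
    by (rule cover_on_cong) (use assms in auto)
  then show "(LEAST d. cover_on s {..<n} {..<m} M d) = (LEAST d. cover_on s {..<n} {..<m} M' d)"
    by simp
qed

lemma rank_le_tester_correct:
  "one_sided_adaptive_tester (\<lambda>s d n m M. sbrank s n m M \<le> d)
     (\<lambda>eps d s n m. 90 * real d * real (binom_le d s) * 2 ^ d / eps) rank_le_tester"
  unfolding one_sided_adaptive_tester_def
proof (intro allI impI conjI ballI)
  fix eps :: real and d s n m :: nat and t
  assume a: "0 < eps \<and> eps < 1 \<and> 1 \<le> d \<and> 1 \<le> s \<and> 1 \<le> n \<and> 1 \<le> m"
    and t: "t \<in> set_pmf (rank_le_tester eps d s n m)"
  show "queries t \<subseteq> {..<n} \<times> {..<m}" using rank_le_tester_queries(1) a t by blast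
  have "real (depth t) \<le> 45 * real d * real (binom_le d s) * 2 ^ d / eps"
    using rank_le_tester_queries(2) a t by blast
  \<comment> \<open>The factor 2 is slack here; the tester for rank exactly \<open>d\<close> needs
    it because it runs this one with \<open>eps / 2\<close>.\<close>
  also have "\<dots> \<le> 90 * real d * real (binom_le d s) * 2 ^ d / eps"
    using a by (intro divide_right_mono mult_right_mono) auto
  finally show "real (depth t) \<le> 90 * real d * real (binom_le d s) * 2 ^ d / eps" .
qed (use rank_le_tester_complete rank_le_tester_sound in blast)+

lemma rank_eq_tester_correct:
  "one_sided_adaptive_tester (\<lambda>s d n m M. sbrank s n m M = d)
     (\<lambda>eps d s n m. 90 * real d * real (binom_le d s) * 2 ^ d / eps) rank_eq_tester"
  unfolding one_sided_adaptive_tester_def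
proof (intro allI impI)
  fix eps :: real and d s n m :: nat
  assume a: "0 < eps \<and> eps < 1 \<and> 1 \<le> d \<and> 1 \<le> s \<and> 1 \<le> n \<and> 1 \<le> m"
  let ?T = "rank_eq_tester eps d s n m" and ?q = "90 * real d * real (binom_le d s) * 2 ^ d / eps"
  let ?claim = "(\<forall>t\<in>set_pmf ?T. queries t \<subseteq> {..<n} \<times> {..<m} \<and> real (depth t) \<le> ?q) \<and>
        (\<forall>M. sbrank s n m M = d \<longrightarrow> measure_pmf.prob ?T {t. run t M} = 1) \<and>
        (\<forall>M. eps_far (\<lambda>M. sbrank s n m M = d) eps n m M \<longrightarrow>
              measure_pmf.prob ?T {t. \<not> run t M} \<ge> 2/3)"
  have q0: "0 \<le> ?q" using a by simp
  consider "n < d \<or> m < d"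
    | "d \<le> n" "d \<le> m" "eps * real n * real m \<le> 2 * real d * real d"
    | "d \<le> n" "d \<le> m" "2 * real d * real d < eps * real n * real m"
    by linarith
  then show ?claim
  proof cases
    case 1
    then have T: "?T = return_pmf (Leaf False)" by (simp add: rank_eq_tester_def)
    have "sbrank s n m M \<noteq> d" for M
      using 1 a sbrank_le_rows[of s n m M] sbrank_le_cols[of s n m M] by auto
    then show ?thesis using q0 by (simp add: T)
  next
    case 2
    let ?t = "query_set ({..<n} \<times> {..<m}) (\<lambda>_ _. False) (\<lambda>N. Leaf (sbrank s n m N = d))"
    have T: "?T = return_pmf ?t" using 2 by (simp add: rank_eq_tester_def)
    have fin: "finite ({..<n} \<times> {..<m})" by simp
    have run: "run ?t M \<longleftrightarrow> sbrank s n m M = d" for M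
    proof -
      have "sbrank s n m (\<lambda>i j. if (i, j) \<in> {..<n} \<times> {..<m} then M i j else False) = sbrank s n m M"
        by (rule sbrank_cong) simp
      then show ?thesis by (simp only: run_query_set[OF fin] run.simps)
    qed
    have "queries ?t \<subseteq> {..<n} \<times> {..<m} \<union> {}" by (rule queries_query_set) simp_all
    moreover have "real (depth ?t) \<le> ?q"
    proof -
      have "depth ?t \<le> card ({..<n} \<times> {..<m}) + 0" by (rule depth_query_set) simp_all
      then have "real (depth ?t) \<le> real n * real m" by (simp flip: of_nat_mult add: card_cartesian_product)
      also have "\<dots> \<le> 2 * real d * real d / eps" using 2 a by (simp add: field_simps)
      \<comment> \<open>One of the two factors \<open>d\<close> is bounded by \<open>2 ^ d\<close>,
        so reading a matrix this small stays within the budget.\<close>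
      also have "\<dots> \<le> 90 * real d * (real (binom_le d s) * 2 ^ d) / eps"
      proof (intro divide_right_mono mult_mono)
        have "real d \<le> 2 ^ d" using less_exp[of d] by (metis less_imp_le of_nat_le_iff of_nat_numeral of_nat_power)
        also have "\<dots> \<le> real (binom_le d s) * 2 ^ d"
          using binom_le_pos[of d s] by simp
        finally show "real d \<le> real (binom_le d s) * 2 ^ d" .
      qed (use a in auto)
      finally show ?thesis by (simp add: mult.assoc)
    qed
    \<comment> \<open>A matrix of rank \<open>d\<close> has distance 0 from itself and so is not
      far.\<close>
    moreover have "sbrank s n m M \<noteq> d" if "eps_far (\<lambda>M. sbrank s n m M = d) eps n m M" for M
    proof
      assume "sbrank s n m M = d"
      then have "eps * real n * real m < real (mat_dist n m M M)"
        using that unfolding eps_far_def by blast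
      moreover have "mat_dist n m M M = 0" by (simp add: mat_dist_def)
      moreover have "0 \<le> eps * real n * real m" using a by simp
      ultimately show False by simp
    qed
    ultimately show ?thesis by (simp add: T run)
  next
    case 3
    then have T: "?T = rank_le_tester (eps / 2) d s n m" by (simp add: rank_eq_tester_def)
    have e: "0 < eps / 2" "eps / 2 < 1" using a by auto
    have "real (depth t) \<le> ?q" if "t \<in> set_pmf ?T" for t
      using rank_le_tester_queries(2)[OF e, of d n m t s] that a by (simp add: T)
    moreover have "queries t \<subseteq> {..<n} \<times> {..<m}" if "t \<in> set_pmf ?T" for t
      using rank_le_tester_queries(1)[OF e, of d n m t s] that a by (simp add: T)
    moreover have "measure_pmf.prob ?T {t. run t M} = 1" if "sbrank s n m M = d" for M
      unfolding T by (rule rank_le_tester_complete) (use a that in auto)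
    moreover have "measure_pmf.prob ?T {t. \<not> run t M} \<ge> 2/3"
      if "eps_far (\<lambda>M. sbrank s n m M = d) eps n m M" for M
      unfolding T using e a 3 that by (intro rank_le_tester_sound far_from_rank_le) auto
    ultimately show ?thesis by blast
  qed
qed

theorem theorem1:
  shows "\<exists>C::real. C > 0 \<and>
    (\<exists>T. one_sided_adaptive_tester
           (\<lambda>s d n m M. sbrank s n m M \<le> d)
           (\<lambda>eps d s n m. C * real d * real (binom_le d s) * 2 ^ d / eps) T) \<and>
    (\<exists>T. one_sided_adaptive_tester
           (\<lambda>s d n m M. sbrank s n m M = d)
           (\<lambda>eps d s n m. C * real d * real (binom_le d s) * 2 ^ d / eps) T)"
proof (rule exI[of _ 90], intro conjI)
  show "\<exists>T. one_sided_adaptive_tester (\<lambda>s d n m M. sbrank s n m M \<le> d)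
     (\<lambda>eps d s n m. 90 * real d * real (binom_le d s) * 2 ^ d / eps) T"
    by (rule exI, rule rank_le_tester_correct)
  show "\<exists>T. one_sided_adaptive_tester (\<lambda>s d n m M. sbrank s n m M = d)
     (\<lambda>eps d s n m. 90 * real d * real (binom_le d s) * 2 ^ d / eps) T"
    by (rule exI, rule rank_eq_tester_correct)
qed simp

end
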